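(* Let $\mathcal A$ be a Grothendieck category and $\mathbf F=(F,\delta,\xi)$ a comonad in $\mathcal A$ whose functor $F$ preserves cokernels and commutes with direct sums. For any $\mathbf F$-bicomodule $(\mathsf M,\mathfrak m,\mathfrak n)$ there is a natural isomorphism of additive groups $$\mathrm{Coint}(\mathsf M,F)\xrightarrow{\ \sim\ }\mathrm{Coder}(\mathsf M,F),\qquad h\mapsto \xi_F\circ h,$$ with inverse $g\mapsto Fg\circ\mathfrak m$, whose restriction to the inner subgroups gives again an isomorphism $$\mathrm{InCoint}(\mathsf M,F)\cong\mathrm{InCoder}(\mathsf M,F).$$
   Context: Functors are additive. A comonad $\mathbf F=(F,\delta,\xi)$ in $\mathcal A$ is an endofunctor $F$ with natural transformations $\delta:F\to F^2$, $\xi:F\to \mathrm{id}_{\mathcal A}$ such that $\delta_F\circ\delta=F\delta\circ\delta$ and $F\xi\circ\delta=\xi_F\circ\delta=F$ (an object or functor also denotes its identity). For a natural transformation $\beta$ and functors $H,I$, $\beta_I$ has components $\beta_{I(Z)}$ and $H\beta$ has components $H(\beta_X)$. An $\mathbf F$-bicomodule is a triple $(\mathsf M,\mathfrak m,\mathfrak n)$ with $\mathsf M:\mathcal A\to\mathcal A$ an additive functor preserving cokernels and commuting with direct sums, and natural transformations $\mathfrak m:\mathsf M\to F\mathsf M$, $\mathfrak n:\mathsf M\to\mathsf MF$ with $\delta_{\mathsf M}\circ\mathfrak m=F\mathfrak m\circ\mathfrak m$, $\xi_{\mathsf M}\circ\mathfrak m=\mathsf M$, $\mathsf M\delta\circ\mathfrak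 n=\mathfrak n_F\circ\mathfrak n$, $\mathsf M\xi\circ\mathfrak n=\mathsf M$, $\mathfrak m_F\circ\mathfrak n=F\mathfrak n\circ\mathfrak m$. Morphisms of bicomodules are natural transformations $f$ with $\mathfrak m'\circ f=Ff\circ\mathfrak m$ and $\mathfrak n'\circ f=f_F\circ\mathfrak n$. $F$ is regarded as the bicomodule $(F,\delta,\delta)$. $\mathrm{Coder}(\mathsf M,F)$ is the additive group of coderivations: natural transformations $g:\mathsf M\to F$ with $\delta\circ g=Fg\circ\mathfrak m+g_F\circ\mathfrak n$. $\mathrm{InCoder}(\mathsf M,F)$ is the subgroup of inner ones, i.e. those with $g=\lambda_F\circ\mathfrak n-F\lambda\circ\mathfrak m$ for some natural transformation $\lambda:\mathsf M\to\mathrm{id}_{\mathcal A}$. $\mathrm{Coint}(\mathsf M,\mathsf M')$ is the additive group of cointegrations from $(\mathsf M,\mathfrak m,\mathfrak n)$ into $(\mathsf M',\mathfrak m',\mathfrak n')$: natural transformations $h:\mathsf M\to\mathsf M'F$ with $\mathfrak m'_F\circ h=Fh\circ\mathfrak m$ and $\mathsf M'\delta\circ h=\mathfrak n'_F\circ h+h_F\circ\mathfrak n$. $\mathrm{InCoint}(\mathsf M,\mathsf M')$ is the subgroup of inner ones, i.e. those for which there is a natural transformation $\varphi:\mathsf M\to\mathsf M'$ with $\mathfrak m'\circ\varphi=F\varphi\circ\mathfrak m$ and $h=\varphi_F\circ\mathfrak n-\mathfrak n'\circ\varphi$. *)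

theory Defs
  imports "HOL-Algebra.Group" "HOL-Library.Equipollence"
begin

section \<open>Categories, functors, natural transformations\<close>

record ('o, 'm) cat =
  Ob  :: "'o set"
  Ar  :: "'m set"
  Dom :: "'m \<Rightarrow> 'o"
  Cod :: "'m \<Rightarrow> 'o"
  Ide :: "'o \<Rightarrow> 'm"
  Cmp :: "'m \<Rightarrow> 'm \<Rightarrow> 'm"  (infixl "\<cdot>\<index>" 70)

definition mor :: "('o, 'm, 'z) cat_scheme \<Rightarrow> 'o \<Rightarrow> 'o \<Rightarrow> 'm set" where
  "mor C X Y = {f \<in> Ar C. Dom C f = X \<and> Cod C f = Y}"

locale category =
  fixes C :: "('o, 'm, 'z) cat_scheme" (structure)
  assumes Dom_Ob: "f \<in> Ar C \<Longrightarrow> Dom C f \<in> Ob C"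
    and Cod_Ob: "f \<in> Ar C \<Longrightarrow> Cod C f \<in> Ob C"
    and Ide_mor: "X \<in> Ob C \<Longrightarrow> Ide C X \<in> mor C X X"
    and Cmp_mor: "f \<in> mor C X Y \<Longrightarrow> g \<in> mor C Y Z \<Longrightarrow> g \<cdot> f \<in> mor C X Z"
    and Cmp_Ide: "f \<in> mor C X Y \<Longrightarrow> f \<cdot> Ide C X = f"
    and Ide_Cmp: "f \<in> mor C X Y \<Longrightarrow> Ide C Y \<cdot> f = f"
    and Cmp_assoc: "f \<in> mor C W X \<Longrightarrow> g \<in> mor C X Y \<Longrightarrow> h \<in> mor C Y Z \<Longrightarrow>
      h \<cdot> (g \<cdot> f) = h \<cdot> g \<cdot> f"

record ('o, 'm, 'p, 'n) cfun =
  OMap :: "'o \<Rightarrow> 'p"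
  AMap :: "'m \<Rightarrow> 'n"

definition is_functor ::
  "('o, 'm, 'y) cat_scheme \<Rightarrow> ('p, 'n, 'z) cat_scheme \<Rightarrow> ('o, 'm, 'p, 'n) cfun \<Rightarrow> bool" where
  "is_functor C D F \<longleftrightarrow> category C \<and> category D \<and>
     (\<forall>X\<in>Ob C. OMap F X \<in> Ob D) \<and>
     (\<forall>f\<in>Ar C. AMap F f \<in> mor D (OMap F (Dom C f)) (OMap F (Cod C f))) \<and>
     (\<forall>X\<in>Ob C. AMap F (Ide C X) = Ide D (OMap F X)) \<and>
     (\<forall>X Y Z. \<forall>f\<in>mor C X Y. \<forall>g\<in>mor C Y Z.
        AMap F (g \<cdot>\<^bsub>C\<^esub> f) = AMap F g \<cdot>\<^bsub>D\<^esub> AMap F f)"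

definition id_fun :: "('o, 'm, 'o, 'm) cfun" where
  "id_fun = \<lparr>OMap = (\<lambda>X. X), AMap = (\<lambda>f. f)\<rparr>"

definition comp_fun ::
  "('p, 'n, 'q, 'l) cfun \<Rightarrow> ('o, 'm, 'p, 'n) cfun \<Rightarrow> ('o, 'm, 'q, 'l) cfun"  (infixr "\<odot>" 75) where
  "G \<odot> F = \<lparr>OMap = (\<lambda>X. OMap G (OMap F X)), AMap = (\<lambda>f. AMap G (AMap F f))\<rparr>"

text \<open>Families of components are \<^const>\<open>extensional\<close>, so that HOL equality of natural
  transformations is equality of all components.\<close>

definition nat_trans ::
  "('o, 'm, 'y) cat_scheme \<Rightarrow> ('p, 'n, 'z) cat_scheme \<Rightarrow>
   ('o, 'm, 'p, 'n) cfun \<Rightarrow> ('o, 'm, 'p, 'n) cfun \<Rightarrow> ('o \<Rightarrow> 'n) set" where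
  "nat_trans C D F G = {\<eta> \<in> extensional (Ob C).
     (\<forall>X\<in>Ob C. \<eta> X \<in> mor D (OMap F X) (OMap G X)) \<and>
     (\<forall>f\<in>Ar C. \<eta> (Cod C f) \<cdot>\<^bsub>D\<^esub> AMap F f = AMap G f \<cdot>\<^bsub>D\<^esub> \<eta> (Dom C f))}"


section \<open>Abelian and Grothendieck categories\<close>

record ('o, 'm) acat = "('o, 'm) cat" +
  Add :: "'m \<Rightarrow> 'm \<Rightarrow> 'm"
  Zer :: "'o \<Rightarrow> 'o \<Rightarrow> 'm"

definition hom_group :: "('o, 'm, 'z) acat_scheme \<Rightarrow> 'o \<Rightarrow> 'o \<Rightarrow> 'm monoid" where
  "hom_group A X Y = \<lparr>carrier = mor A X Y, monoid.mult = Add A, one = Zer A X Y\<rparr>"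

locale preadditive_category = category A
  for A :: "('o, 'm, 'z) acat_scheme" (structure) +
  assumes hom_comm_group: "X \<in> Ob A \<Longrightarrow> Y \<in> Ob A \<Longrightarrow> comm_group (hom_group A X Y)"
    and Cmp_Add_left: "f \<in> mor A X Y \<Longrightarrow> g \<in> mor A Y Z \<Longrightarrow> g' \<in> mor A Y Z \<Longrightarrow>
      Add A g g' \<cdot> f = Add A (g \<cdot> f) (g' \<cdot> f)"
    and Cmp_Add_right: "f \<in> mor A X Y \<Longrightarrow> f' \<in> mor A X Y \<Longrightarrow> g \<in> mor A Y Z \<Longrightarrow>
      g \<cdot> Add A f f' = Add A (g \<cdot> f) (g \<cdot> f')"

definition is_zero_object :: "('o, 'm, 'z) cat_scheme \<Rightarrow> 'o \<Rightarrow> bool" where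
  "is_zero_object A Z \<longleftrightarrow> Z \<in> Ob A \<and>
     (\<forall>X\<in>Ob A. (\<exists>!f. f \<in> mor A Z X) \<and> (\<exists>!f. f \<in> mor A X Z))"

definition is_biproduct ::
  "('o, 'm, 'z) acat_scheme \<Rightarrow> 'o \<Rightarrow> 'o \<Rightarrow> 'o \<Rightarrow> 'm \<Rightarrow> 'm \<Rightarrow> 'm \<Rightarrow> 'm \<Rightarrow> bool" where
  "is_biproduct A X Y S i j p q \<longleftrightarrow> S \<in> Ob A \<and>
     i \<in> mor A X S \<and> j \<in> mor A Y S \<and> p \<in> mor A S X \<and> q \<in> mor A S Y \<and>
     p \<cdot>\<^bsub>A\<^esub> i = Ide A X \<and> q \<cdot>\<^bsub>A\<^esub> j = Ide A Y \<and>
     p \<cdot>\<^bsub>A\<^esub> j = Zer A Y X \<and> q \<cdot>\<^bsub>A\<^esub> i = Zer A X Y \<and>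
     Add A (i \<cdot>\<^bsub>A\<^esub> p) (j \<cdot>\<^bsub>A\<^esub> q) = Ide A S"

definition is_kernel :: "('o, 'm, 'z) acat_scheme \<Rightarrow> 'm \<Rightarrow> 'm \<Rightarrow> bool" where
  "is_kernel A f k \<longleftrightarrow> f \<in> Ar A \<and> k \<in> Ar A \<and> Cod A k = Dom A f \<and>
     f \<cdot>\<^bsub>A\<^esub> k = Zer A (Dom A k) (Cod A f) \<and>
     (\<forall>t\<in>Ar A. Cod A t = Dom A f \<and> f \<cdot>\<^bsub>A\<^esub> t = Zer A (Dom A t) (Cod A f) \<longrightarrow>
        (\<exists>!u. u \<in> mor A (Dom A t) (Dom A k) \<and> k \<cdot>\<^bsub>A\<^esub> u = t))"

definition is_cokernel :: "('o, 'm, 'z) acat_scheme \<Rightarrow> 'm \<Rightarrow> 'm \<Rightarrow> bool" where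
  "is_cokernel A f c \<longleftrightarrow> f \<in> Ar A \<and> c \<in> Ar A \<and> Dom A c = Cod A f \<and>
     c \<cdot>\<^bsub>A\<^esub> f = Zer A (Dom A f) (Cod A c) \<and>
     (\<forall>t\<in>Ar A. Dom A t = Cod A f \<and> t \<cdot>\<^bsub>A\<^esub> f = Zer A (Dom A f) (Cod A t) \<longrightarrow>
        (\<exists>!u. u \<in> mor A (Cod A c) (Cod A t) \<and> u \<cdot>\<^bsub>A\<^esub> c = t))"

definition is_mono :: "('o, 'm, 'z) cat_scheme \<Rightarrow> 'm \<Rightarrow> bool" where
  "is_mono A f \<longleftrightarrow> f \<in> Ar A \<and>
     (\<forall>W. \<forall>s\<in>mor A W (Dom A f). \<forall>t\<in>mor A W (Dom A f). f \<cdot>\<^bsub>A\<^esub> s = f \<cdot>\<^bsub>A\<^esub> t \<longrightarrow> s = t)"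

definition is_epi :: "('o, 'm, 'z) cat_scheme \<Rightarrow> 'm \<Rightarrow> bool" where
  "is_epi A f \<longleftrightarrow> f \<in> Ar A \<and>
     (\<forall>W. \<forall>s\<in>mor A (Cod A f) W. \<forall>t\<in>mor A (Cod A f) W. s \<cdot>\<^bsub>A\<^esub> f = t \<cdot>\<^bsub>A\<^esub> f \<longrightarrow> s = t)"

definition short_exact :: "('o, 'm, 'z) acat_scheme \<Rightarrow> 'm \<Rightarrow> 'm \<Rightarrow> bool" where
  "short_exact A f g \<longleftrightarrow> is_kernel A g f \<and> is_cokernel A f g"

locale abelian_category = preadditive_category A
  for A :: "('o, 'm, 'z) acat_scheme" (structure) +
  assumes has_zero_object: "\<exists>Z. is_zero_object A Z"
    and has_biproducts: "X \<in> Ob A \<Longrightarrow> Y \<in> Ob A \<Longrightarrow> \<exists>S i j p q. is_biproduct A X Y S i j p q"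
    and has_kernels: "f \<in> Ar A \<Longrightarrow> \<exists>k. is_kernel A f k"
    and has_cokernels: "f \<in> Ar A \<Longrightarrow> \<exists>c. is_cokernel A f c"
    and mono_is_kernel: "is_mono A k \<Longrightarrow> \<exists>f. is_kernel A f k"
    and epi_is_cokernel: "is_epi A c \<Longrightarrow> \<exists>f. is_cokernel A f c"

definition is_coproduct ::
  "('o, 'm, 'z) cat_scheme \<Rightarrow> 'i set \<Rightarrow> ('i \<Rightarrow> 'o) \<Rightarrow> 'o \<Rightarrow> ('i \<Rightarrow> 'm) \<Rightarrow> bool" where
  "is_coproduct A I X S \<iota> \<longleftrightarrow> S \<in> Ob A \<and> (\<forall>i\<in>I. X i \<in> Ob A \<and> \<iota> i \<in> mor A (X i) S) \<and>
     (\<forall>T\<in>Ob A. \<forall>t. (\<forall>i\<in>I. t i \<in> mor A (X i) T) \<longrightarrow>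
        (\<exists>!u. u \<in> mor A S T \<and> (\<forall>i\<in>I. u \<cdot>\<^bsub>A\<^esub> \<iota> i = t i)))"

definition is_colimit ::
  "('i, 'j, 'y) cat_scheme \<Rightarrow> ('o, 'm, 'z) cat_scheme \<Rightarrow> ('i, 'j, 'o, 'm) cfun \<Rightarrow>
   'o \<Rightarrow> ('i \<Rightarrow> 'm) \<Rightarrow> bool" where
  "is_colimit J A D L c \<longleftrightarrow> L \<in> Ob A \<and> (\<forall>i\<in>Ob J. c i \<in> mor A (OMap D i) L) \<and>
     (\<forall>f\<in>Ar J. c (Cod J f) \<cdot>\<^bsub>A\<^esub> AMap D f = c (Dom J f)) \<and>
     (\<forall>T\<in>Ob A. \<forall>t. (\<forall>i\<in>Ob J. t i \<in> mor A (OMap D i) T) \<and>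
        (\<forall>f\<in>Ar J. t (Cod J f) \<cdot>\<^bsub>A\<^esub> AMap D f = t (Dom J f)) \<longrightarrow>
        (\<exists>!u. u \<in> mor A L T \<and> (\<forall>i\<in>Ob J. u \<cdot>\<^bsub>A\<^esub> c i = t i)))"

definition filtered :: "('i, 'j, 'y) cat_scheme \<Rightarrow> bool" where
  "filtered J \<longleftrightarrow> category J \<and> Ob J \<noteq> {} \<and>
     (\<forall>i\<in>Ob J. \<forall>j\<in>Ob J. \<exists>k\<in>Ob J. mor J i k \<noteq> {} \<and> mor J j k \<noteq> {}) \<and>
     (\<forall>i j. \<forall>f\<in>mor J i j. \<forall>g\<in>mor J i j. \<exists>k. \<exists>h\<in>mor J j k. h \<cdot>\<^bsub>J\<^esub> f = h \<cdot>\<^bsub>J\<^esub> g)"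

text \<open>Size: the type \<open>'u\<close> plays the role of the universe, and a set is small if it has strictly
  smaller cardinality than \<open>'u\<close>.  When that cardinality is inaccessible this is smallness with
  respect to the corresponding Grothendieck universe.  No closure property of \<open>'u\<close> and no bound
  on the hom-sets is imposed, so that the definitions make sense for every type.\<close>

definition small :: "'u set \<Rightarrow> bool" where
  "small I \<longleftrightarrow> I \<prec> (UNIV :: 'u set)"

definition has_small_coproducts :: "'u itself \<Rightarrow> ('o, 'm, 'z) cat_scheme \<Rightarrow> bool" where
  "has_small_coproducts U A \<longleftrightarrow>
     (\<forall>(I :: 'u set) X. small I \<and> (\<forall>i\<in>I. X i \<in> Ob A) \<longrightarrow> (\<exists>S \<iota>. is_coproduct A I X S \<iota>))"

definition filtered_colimits_exact :: "'u itself \<Rightarrow> ('o, 'm, 'z) acat_scheme \<Rightarrow> bool" where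
  "filtered_colimits_exact U A \<longleftrightarrow>
     (\<forall>(J :: ('u, 'u) cat) D D' D'' \<alpha> \<beta> L L' L'' c c' c'' u v.
        filtered J \<and> small (Ob J) \<and> small (Ar J) \<and>
        is_functor J A D \<and> is_functor J A D' \<and> is_functor J A D'' \<and>
        \<alpha> \<in> nat_trans J A D D' \<and> \<beta> \<in> nat_trans J A D' D'' \<and>
        (\<forall>i\<in>Ob J. short_exact A (\<alpha> i) (\<beta> i)) \<and>
        is_colimit J A D L c \<and> is_colimit J A D' L' c' \<and> is_colimit J A D'' L'' c'' \<and>
        u \<in> mor A L L' \<and> (\<forall>i\<in>Ob J. u \<cdot>\<^bsub>A\<^esub> c i = c' i \<cdot>\<^bsub>A\<^esub> \<alpha> i) \<and>
        v \<in> mor A L' L'' \<and> (\<forall>i\<in>Ob J. v \<cdot>\<^bsub>A\<^esub> c' i = c'' i \<cdot>\<^bsub>A\<^esub> \<beta> i)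
        \<longrightarrow> short_exact A u v)"

definition is_generator :: "('o, 'm, 'z) cat_scheme \<Rightarrow> 'o \<Rightarrow> bool" where
  "is_generator A G \<longleftrightarrow> G \<in> Ob A \<and>
     (\<forall>X Y. \<forall>f\<in>mor A X Y. \<forall>g\<in>mor A X Y. f \<noteq> g \<longrightarrow>
        (\<exists>h\<in>mor A G X. f \<cdot>\<^bsub>A\<^esub> h \<noteq> g \<cdot>\<^bsub>A\<^esub> h))"

locale grothendieck_category = abelian_category A
  for U :: "'u itself" and A :: "('o, 'm, 'z) acat_scheme" (structure) +
  assumes small_coproducts: "has_small_coproducts U A"
    and AB5: "filtered_colimits_exact U A"
    and has_generator: "\<exists>G. is_generator A G"


section \<open>Additive endofunctors and calculus of natural transformations\<close>

definition additive_endofunctor :: "('o, 'm, 'z) acat_scheme \<Rightarrow> ('o, 'm, 'o, 'm) cfun \<Rightarrow> bool" where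
  "additive_endofunctor A F \<longleftrightarrow> is_functor A A F \<and>
     (\<forall>X Y. \<forall>f\<in>mor A X Y. \<forall>g\<in>mor A X Y. AMap F (Add A f g) = Add A (AMap F f) (AMap F g))"

definition preserves_cokernels :: "('o, 'm, 'z) acat_scheme \<Rightarrow> ('o, 'm, 'o, 'm) cfun \<Rightarrow> bool" where
  "preserves_cokernels A F \<longleftrightarrow>
     (\<forall>f c. is_cokernel A f c \<longrightarrow> is_cokernel A (AMap F f) (AMap F c))"

definition commutes_with_direct_sums ::
  "'u itself \<Rightarrow> ('o, 'm, 'z) cat_scheme \<Rightarrow> ('o, 'm, 'o, 'm) cfun \<Rightarrow> bool" where
  "commutes_with_direct_sums U A F \<longleftrightarrow>
     (\<forall>(I :: 'u set) X S \<iota>. small I \<and> is_coproduct A I X S \<iota> \<longrightarrow>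
        is_coproduct A I (\<lambda>i. OMap F (X i)) (OMap F S) (\<lambda>i. AMap F (\<iota> i)))"

definition nt_id :: "('o, 'm, 'z) cat_scheme \<Rightarrow> ('o, 'm, 'o, 'm) cfun \<Rightarrow> 'o \<Rightarrow> 'm" where
  "nt_id A H = (\<lambda>X\<in>Ob A. Ide A (OMap H X))"

definition nt_comp :: "('o, 'm, 'z) cat_scheme \<Rightarrow> ('o \<Rightarrow> 'm) \<Rightarrow> ('o \<Rightarrow> 'm) \<Rightarrow> 'o \<Rightarrow> 'm"
  (infixl "\<bullet>\<index>" 65) where
  "\<beta> \<bullet>\<^bsub>A\<^esub> \<alpha> = (\<lambda>X\<in>Ob A. \<beta> X \<cdot>\<^bsub>A\<^esub> \<alpha> X)"

text \<open>\<open>nt_at A \<beta> I\<close> is $\beta_I$ and \<open>nt_map A H \<beta>\<close> is $H\beta$.\<close>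

definition nt_at ::
  "('o, 'm, 'z) cat_scheme \<Rightarrow> ('o \<Rightarrow> 'm) \<Rightarrow> ('o, 'm, 'o, 'm) cfun \<Rightarrow> 'o \<Rightarrow> 'm" where
  "nt_at A \<beta> I = (\<lambda>X\<in>Ob A. \<beta> (OMap I X))"

definition nt_map ::
  "('o, 'm, 'z) cat_scheme \<Rightarrow> ('o, 'm, 'o, 'm) cfun \<Rightarrow> ('o \<Rightarrow> 'm) \<Rightarrow> 'o \<Rightarrow> 'm" where
  "nt_map A H \<beta> = (\<lambda>X\<in>Ob A. AMap H (\<beta> X))"

definition nt_add :: "('o, 'm, 'z) acat_scheme \<Rightarrow> ('o \<Rightarrow> 'm) \<Rightarrow> ('o \<Rightarrow> 'm) \<Rightarrow> 'o \<Rightarrow> 'm" where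
  "nt_add A \<alpha> \<beta> = (\<lambda>X\<in>Ob A. Add A (\<alpha> X) (\<beta> X))"

definition nt_diff :: "('o, 'm, 'z) acat_scheme \<Rightarrow> ('o \<Rightarrow> 'm) \<Rightarrow> ('o \<Rightarrow> 'm) \<Rightarrow> 'o \<Rightarrow> 'm" where
  "nt_diff A \<alpha> \<beta> = (\<lambda>X\<in>Ob A.
     Add A (\<alpha> X) (inv\<^bsub>hom_group A (Dom A (\<beta> X)) (Cod A (\<beta> X))\<^esub> (\<beta> X)))"

definition nt_group ::
  "('o, 'm, 'z) acat_scheme \<Rightarrow> ('o, 'm, 'o, 'm) cfun \<Rightarrow> ('o, 'm, 'o, 'm) cfun \<Rightarrow>
   ('o \<Rightarrow> 'm) monoid" where
  "nt_group A H I = \<lparr>carrier = nat_trans A A H I, monoid.mult = nt_add A,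
     one = (\<lambda>X\<in>Ob A. Zer A (OMap H X) (OMap I X))\<rparr>"


section \<open>Comonads and bicomodules\<close>

definition comonad ::
  "('o, 'm, 'z) acat_scheme \<Rightarrow> ('o, 'm, 'o, 'm) cfun \<Rightarrow> ('o \<Rightarrow> 'm) \<Rightarrow> ('o \<Rightarrow> 'm) \<Rightarrow> bool" where
  "comonad A F \<delta> \<xi> \<longleftrightarrow> additive_endofunctor A F \<and>
     \<delta> \<in> nat_trans A A F (F \<odot> F) \<and> \<xi> \<in> nat_trans A A F id_fun \<and>
     nt_at A \<delta> F \<bullet>\<^bsub>A\<^esub> \<delta> = nt_map A F \<delta> \<bullet>\<^bsub>A\<^esub> \<delta> \<and>
     nt_map A F \<xi> \<bullet>\<^bsub>A\<^esub> \<delta> = nt_id A F \<and>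
     nt_at A \<xi> F \<bullet>\<^bsub>A\<^esub> \<delta> = nt_id A F"

type_synonym ('o, 'm) bicomod = "('o, 'm, 'o, 'm) cfun \<times> ('o \<Rightarrow> 'm) \<times> ('o \<Rightarrow> 'm)"

fun bicomodule ::
  "'u itself \<Rightarrow> ('o, 'm, 'z) acat_scheme \<Rightarrow> ('o, 'm, 'o, 'm) cfun \<Rightarrow> ('o \<Rightarrow> 'm) \<Rightarrow> ('o \<Rightarrow> 'm) \<Rightarrow>
   ('o, 'm) bicomod \<Rightarrow> bool" where
  "bicomodule U A F \<delta> \<xi> (M, m, n) \<longleftrightarrow>
     additive_endofunctor A M \<and> preserves_cokernels A M \<and> commutes_with_direct_sums U A M \<and>
     m \<in> nat_trans A A M (F \<odot> M) \<and> n \<in> nat_trans A A M (M \<odot> F) \<and>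
     nt_at A \<delta> M \<bullet>\<^bsub>A\<^esub> m = nt_map A F m \<bullet>\<^bsub>A\<^esub> m \<and>
     nt_at A \<xi> M \<bullet>\<^bsub>A\<^esub> m = nt_id A M \<and>
     nt_map A M \<delta> \<bullet>\<^bsub>A\<^esub> n = nt_at A n F \<bullet>\<^bsub>A\<^esub> n \<and>
     nt_map A M \<xi> \<bullet>\<^bsub>A\<^esub> n = nt_id A M \<and>
     nt_at A m F \<bullet>\<^bsub>A\<^esub> n = nt_map A F n \<bullet>\<^bsub>A\<^esub> m"

fun bicomod_morphisms ::
  "('o, 'm, 'z) acat_scheme \<Rightarrow> ('o, 'm, 'o, 'm) cfun \<Rightarrow>
   ('o, 'm) bicomod \<Rightarrow> ('o, 'm) bicomod \<Rightarrow> ('o \<Rightarrow> 'm) set" where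
  "bicomod_morphisms A F (M, m, n) (M', m', n') = {f \<in> nat_trans A A M M'.
     m' \<bullet>\<^bsub>A\<^esub> f = nt_map A F f \<bullet>\<^bsub>A\<^esub> m \<and>
     n' \<bullet>\<^bsub>A\<^esub> f = nt_at A f F \<bullet>\<^bsub>A\<^esub> n}"


section \<open>Coderivations and cointegrations\<close>

fun Coder ::
  "('o, 'm, 'z) acat_scheme \<Rightarrow> ('o, 'm, 'o, 'm) cfun \<Rightarrow> ('o \<Rightarrow> 'm) \<Rightarrow>
   ('o, 'm) bicomod \<Rightarrow> ('o \<Rightarrow> 'm) monoid" where
  "Coder A F \<delta> (M, m, n) = (nt_group A M F)\<lparr>carrier := {g \<in> nat_trans A A M F.
     \<delta> \<bullet>\<^bsub>A\<^esub> g = nt_add A (nt_map A F g \<bullet>\<^bsub>A\<^esub> m) (nt_at A g F \<bullet>\<^bsub>A\<^esub> n)}\<rparr>"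

fun InCoder ::
  "('o, 'm, 'z) acat_scheme \<Rightarrow> ('o, 'm, 'o, 'm) cfun \<Rightarrow> ('o \<Rightarrow> 'm) \<Rightarrow>
   ('o, 'm) bicomod \<Rightarrow> ('o \<Rightarrow> 'm) monoid" where
  "InCoder A F \<delta> (M, m, n) = (nt_group A M F)\<lparr>carrier :=
     {g \<in> carrier (Coder A F \<delta> (M, m, n)). \<exists>l\<in>nat_trans A A M id_fun.
        g = nt_diff A (nt_at A l F \<bullet>\<^bsub>A\<^esub> n) (nt_map A F l \<bullet>\<^bsub>A\<^esub> m)}\<rparr>"

fun Coint ::
  "('o, 'm, 'z) acat_scheme \<Rightarrow> ('o, 'm, 'o, 'm) cfun \<Rightarrow> ('o \<Rightarrow> 'm) \<Rightarrow>
   ('o, 'm) bicomod \<Rightarrow> ('o, 'm) bicomod \<Rightarrow> ('o \<Rightarrow> 'm) monoid" where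
  "Coint A F \<delta> (M, m, n) (M', m', n') = (nt_group A M (M' \<odot> F))\<lparr>carrier :=
     {h \<in> nat_trans A A M (M' \<odot> F).
        nt_at A m' F \<bullet>\<^bsub>A\<^esub> h = nt_map A F h \<bullet>\<^bsub>A\<^esub> m \<and>
        nt_map A M' \<delta> \<bullet>\<^bsub>A\<^esub> h = nt_add A (nt_at A n' F \<bullet>\<^bsub>A\<^esub> h) (nt_at A h F \<bullet>\<^bsub>A\<^esub> n)}\<rparr>"

fun InCoint ::
  "('o, 'm, 'z) acat_scheme \<Rightarrow> ('o, 'm, 'o, 'm) cfun \<Rightarrow> ('o \<Rightarrow> 'm) \<Rightarrow>
   ('o, 'm) bicomod \<Rightarrow> ('o, 'm) bicomod \<Rightarrow> ('o \<Rightarrow> 'm) monoid" where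
  "InCoint A F \<delta> (M, m, n) (M', m', n') = (nt_group A M (M' \<odot> F))\<lparr>carrier :=
     {h \<in> carrier (Coint A F \<delta> (M, m, n) (M', m', n')). \<exists>\<phi>\<in>nat_trans A A M M'.
        m' \<bullet>\<^bsub>A\<^esub> \<phi> = nt_map A F \<phi> \<bullet>\<^bsub>A\<^esub> m \<and>
        h = nt_diff A (nt_at A \<phi> F \<bullet>\<^bsub>A\<^esub> n) (n' \<bullet>\<^bsub>A\<^esub> \<phi>)}\<rparr>"

lemma comonad_bicomodule:
  assumes "comonad A F \<delta> \<xi>" "preserves_cokernels A F" "commutes_with_direct_sums U A F"
  shows "bicomodule U A F \<delta> \<xi> (F, \<delta>, \<delta>)"
  using assms by (simp add: comonad_def)

end

theory Submission
  imports Defs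
begin

text \<open>
  For every endofunctor \<open>I\<close>, the functor \<open>F I\<close> with coaction \<open>\<delta>\<^sub>I\<close> is the cofree left comodule
  on \<open>I\<close>: the maps \<open>\<phi> \<mapsto> \<xi>\<^sub>I \<circ> \<phi>\<close> and \<open>\<theta> \<mapsto> F\<theta> \<circ> m\<close> are mutually inverse bijections between the left
  comodule maps \<open>M \<rightarrow> F I\<close> and the natural transformations \<open>M \<rightarrow> I\<close>. For \<open>I = F\<close> this is the
  claimed bijection, and the remaining condition on a cointegration corresponds to the Leibniz
  rule for its image under \<open>\<xi>\<^sub>F\<close>. For \<open>I = id\<close> it matches the left comodule maps \<open>\<phi> : M \<rightarrow> F\<close>
  defining inner cointegrations with the transformations \<open>\<theta> : M \<rightarrow> id\<close> defining inner coderivations.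
\<close>

section \<open>Composite and identity functors\<close>

lemma comp_fun_assoc: "(H \<odot> I) \<odot> J = H \<odot> (I \<odot> J)"
  by (simp add: comp_fun_def)

lemma comp_fun_id [simp]: "H \<odot> id_fun = H" "id_fun \<odot> H = H"
  by (simp_all add: comp_fun_def id_fun_def)

lemma OMap_comp_fun [simp]: "OMap (H \<odot> I) X = OMap H (OMap I X)"
  and AMap_comp_fun [simp]: "AMap (H \<odot> I) f = AMap H (AMap I f)"
  by (simp_all add: comp_fun_def)

lemma id_fun_simps [simp]: "OMap id_fun X = X" "AMap id_fun f = f"
  by (simp_all add: id_fun_def)

lemma (in category) mor_ArD:
  assumes "f \<in> mor C X Y"
  shows "f \<in> Ar C" "Dom C f = X" "Cod C f = Y" "X \<in> Ob C" "Y \<in> Ob C"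
  using assms Dom_Ob Cod_Ob by (auto simp: mor_def)

lemma (in category) Ar_mor: "f \<in> Ar C \<Longrightarrow> f \<in> mor C (Dom C f) (Cod C f)"
  by (simp add: mor_def)

lemma is_functorD:
  assumes "is_functor C D H"
  shows "category C" "category D"
    and "X \<in> Ob C \<Longrightarrow> OMap H X \<in> Ob D"
    and "f \<in> mor C X Y \<Longrightarrow> AMap H f \<in> mor D (OMap H X) (OMap H Y)"
    and "X \<in> Ob C \<Longrightarrow> AMap H (Ide C X) = Ide D (OMap H X)"
    and "f \<in> mor C X Y \<Longrightarrow> g \<in> mor C Y Z \<Longrightarrow>
      AMap H (g \<cdot>\<^bsub>C\<^esub> f) = AMap H g \<cdot>\<^bsub>D\<^esub> AMap H f"
  using assms unfolding is_functor_def by (auto simp: mor_def)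

lemma (in category) is_functor_id_fun: "is_functor C C id_fun"
  using category_axioms by (simp add: is_functor_def Ar_mor)

lemma is_functor_comp_fun:
  assumes "is_functor D E H" "is_functor C D I"
  shows "is_functor C E (H \<odot> I)"
proof -
  note H = is_functorD[OF assms(1)] and I = is_functorD[OF assms(2)]
  show ?thesis
    unfolding is_functor_def
  proof (intro conjI ballI allI)
    fix f assume "f \<in> Ar C"
    then have "f \<in> mor C (Dom C f) (Cod C f)" by (simp add: mor_def)
    then show "AMap (H \<odot> I) f \<in> mor E (OMap (H \<odot> I) (Dom C f)) (OMap (H \<odot> I) (Cod C f))"
      using H(4) I(4) by simp
  next
    fix X Y Z f g assume "f \<in> mor C X Y" "g \<in> mor C Y Z"
    then show "AMap (H \<odot> I) (g \<cdot>\<^bsub>C\<^esub> f) = AMap (H \<odot> I) g \<cdot>\<^bsub>E\<^esub> AMap (H \<odot> I) f"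
      using H(6)[OF I(4) I(4)] I(6) by simp
  qed (use H I in auto)
qed


section \<open>Calculus of natural transformations\<close>

lemma nat_transI:
  assumes "\<eta> \<in> extensional (Ob C)"
    and "\<And>X. X \<in> Ob C \<Longrightarrow> \<eta> X \<in> mor D (OMap H X) (OMap I X)"
    and "\<And>X Y f. f \<in> mor C X Y \<Longrightarrow> \<eta> Y \<cdot>\<^bsub>D\<^esub> AMap H f = AMap I f \<cdot>\<^bsub>D\<^esub> \<eta> X"
  shows "\<eta> \<in> nat_trans C D H I"
  using assms by (auto simp: nat_trans_def mor_def)

lemma nat_transD:
  assumes "\<eta> \<in> nat_trans C D H I"
  shows "\<eta> \<in> extensional (Ob C)"
    and "X \<in> Ob C \<Longrightarrow> \<eta> X \<in> mor D (OMap H X) (OMap I X)"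
    and "f \<in> mor C X Y \<Longrightarrow> \<eta> Y \<cdot>\<^bsub>D\<^esub> AMap H f = AMap I f \<cdot>\<^bsub>D\<^esub> \<eta> X"
  using assms by (auto simp: nat_trans_def mor_def)

lemma nat_trans_eqI:
  assumes "\<alpha> \<in> nat_trans C D H I" "\<beta> \<in> nat_trans C D H' I'" "\<And>X. X \<in> Ob C \<Longrightarrow> \<alpha> X = \<beta> X"
  shows "\<alpha> = \<beta>"
  using assms by (intro extensionalityI[of _ "Ob C"]) (auto dest: nat_transD)

text \<open>Whiskering with the identity is restriction to \<open>Ob A\<close>, so extensionality of
  \<open>\<alpha>\<close> is what gives back \<open>\<alpha>\<close> itself. This and
  \<open>nt_map_id_fun\<close> let the general whiskering rules be read at
  \<open>id_fun\<close>.\<close>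

lemma nt_at_id_fun: "\<alpha> \<in> nat_trans A D H I \<Longrightarrow> nt_at A \<alpha> id_fun = \<alpha>"
  by (auto simp: nt_at_def extensional_restrict dest: nat_transD(1))

lemma nt_map_id_fun: "\<alpha> \<in> nat_trans A D H I \<Longrightarrow> nt_map A id_fun \<alpha> = \<alpha>"
  by (auto simp: nt_map_def extensional_restrict dest: nat_transD(1))

text \<open>In the rules for \<open>nt_at\<close>, functoriality of the whiskering functor keeps its
  values on objects in \<open>Ob A\<close>, where the restricted families can be evaluated.\<close>

lemma nt_at_comp: "is_functor A A K \<Longrightarrow> nt_at A (\<beta> \<bullet>\<^bsub>A\<^esub> \<alpha>) K = nt_at A \<beta> K \<bullet>\<^bsub>A\<^esub> nt_at A \<alpha> K"
  by (auto simp: nt_at_def nt_comp_def is_functorD)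

lemma nt_at_at: "is_functor A A L \<Longrightarrow> nt_at A (nt_at A \<beta> K) L = nt_at A \<beta> (K \<odot> L)"
  by (auto simp: nt_at_def is_functorD)

lemma nt_at_map: "is_functor A A L \<Longrightarrow> nt_at A (nt_map A K \<beta>) L = nt_map A K (nt_at A \<beta> L)"
  by (auto simp: nt_at_def nt_map_def is_functorD)

lemma nt_map_map: "nt_map A K (nt_map A L \<beta>) = nt_map A (K \<odot> L) \<beta>"
  by (auto simp: nt_map_def)

lemma nt_at_nt_id: "is_functor A A K \<Longrightarrow> nt_at A (nt_id A H) K = nt_id A (H \<odot> K)"
  by (auto simp: nt_at_def nt_id_def is_functorD)

lemma nt_at_add: "is_functor A A K \<Longrightarrow> nt_at A (nt_add A \<alpha> \<beta>) K = nt_add A (nt_at A \<alpha> K) (nt_at A \<beta> K)"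
  by (auto simp: nt_at_def nt_add_def is_functorD)

context category
begin

lemma nt_comp_nat_trans:
  assumes "is_functor C C H" "is_functor C C I" "is_functor C C J"
    and "\<alpha> \<in> nat_trans C C H I" "\<beta> \<in> nat_trans C C I J"
  shows "\<beta> \<bullet>\<^bsub>C\<^esub> \<alpha> \<in> nat_trans C C H J"
proof (rule nat_transI)
  note \<alpha> = nat_transD[OF assms(4)] and \<beta> = nat_transD[OF assms(5)]
  fix X Y f assume f: "f \<in> mor C X Y"
  note XY = mor_ArD(4,5)[OF f]
  note Hf = is_functorD(4)[OF assms(1) f] and If = is_functorD(4)[OF assms(2) f]
    and Jf = is_functorD(4)[OF assms(3) f]
  have "\<beta> Y \<cdot> \<alpha> Y \<cdot> AMap H f = \<beta> Y \<cdot> (AMap I f \<cdot> \<alpha> X)"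
    using Cmp_assoc[OF Hf \<alpha>(2) \<beta>(2)] XY \<alpha>(3)[OF f] by simp
  also have "\<dots> = AMap J f \<cdot> \<beta> X \<cdot> \<alpha> X"
    using Cmp_assoc[OF \<alpha>(2) If \<beta>(2)] XY \<beta>(3)[OF f] by simp
  also have "\<dots> = AMap J f \<cdot> (\<beta> X \<cdot> \<alpha> X)"
    using Cmp_assoc[OF \<alpha>(2) \<beta>(2) Jf] XY by simp
  finally show "(\<beta> \<bullet>\<^bsub>C\<^esub> \<alpha>) Y \<cdot> AMap H f = AMap J f \<cdot> (\<beta> \<bullet>\<^bsub>C\<^esub> \<alpha>) X"
    using XY by (simp add: nt_comp_def)
qed (use assms(4,5) in \<open>auto simp: nt_comp_def intro: Cmp_mor dest: nat_transD\<close>)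

lemma nt_at_nat_trans:
  assumes "is_functor C C K" "\<alpha> \<in> nat_trans C C H I"
  shows "nt_at C \<alpha> K \<in> nat_trans C C (H \<odot> K) (I \<odot> K)"
proof (rule nat_transI)
  fix X Y f assume f: "f \<in> mor C X Y"
  show "nt_at C \<alpha> K Y \<cdot> AMap (H \<odot> K) f = AMap (I \<odot> K) f \<cdot> nt_at C \<alpha> K X"
    using nat_transD(3)[OF assms(2) is_functorD(4)[OF assms(1) f]] mor_ArD(4,5)[OF f]
    by (simp add: nt_at_def)
qed (use assms in \<open>auto simp: nt_at_def is_functorD nat_transD\<close>)

lemma nt_map_nat_trans:
  assumes "is_functor C C H" "is_functor C C I" "is_functor C C K" "\<alpha> \<in> nat_trans C C H I"
  shows "nt_map C K \<alpha> \<in> nat_trans C C (K \<odot> H) (K \<odot> I)"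
proof (rule nat_transI)
  note \<alpha> = nat_transD[OF assms(4)]
  fix X Y f assume f: "f \<in> mor C X Y"
  note XY = mor_ArD(4,5)[OF f]
  have "AMap K (\<alpha> Y) \<cdot> AMap K (AMap H f) = AMap K (AMap I f) \<cdot> AMap K (\<alpha> X)"
    using is_functorD(6)[OF assms(3) is_functorD(4)[OF assms(1) f] \<alpha>(2)]
      is_functorD(6)[OF assms(3) \<alpha>(2) is_functorD(4)[OF assms(2) f]] \<alpha>(3)[OF f] XY by simp
  then show "nt_map C K \<alpha> Y \<cdot> AMap (K \<odot> H) f = AMap (K \<odot> I) f \<cdot> nt_map C K \<alpha> X"
    using XY by (simp add: nt_map_def)
qed (use assms in \<open>auto simp: nt_map_def is_functorD nat_transD\<close>)

lemma nt_comp_assoc: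
  assumes "\<alpha> \<in> nat_trans C C H I" "\<beta> \<in> nat_trans C C I J" "\<gamma> \<in> nat_trans C C J K"
  shows "\<gamma> \<bullet>\<^bsub>C\<^esub> \<beta> \<bullet>\<^bsub>C\<^esub> \<alpha> = \<gamma> \<bullet>\<^bsub>C\<^esub> (\<beta> \<bullet>\<^bsub>C\<^esub> \<alpha>)"
  using Cmp_assoc[OF nat_transD(2)[OF assms(1)] nat_transD(2)[OF assms(2)] nat_transD(2)[OF assms(3)]]
  by (auto simp: nt_comp_def)

lemma nt_comp_id:
  assumes "\<alpha> \<in> nat_trans C C H I"
  shows "\<alpha> \<bullet>\<^bsub>C\<^esub> nt_id C H = \<alpha>" "nt_id C I \<bullet>\<^bsub>C\<^esub> \<alpha> = \<alpha>"
  using Cmp_Ide[OF nat_transD(2)[OF assms]] Ide_Cmp[OF nat_transD(2)[OF assms]] nat_transD(1)[OF assms]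
  by (auto intro!: extensionalityI[of _ "Ob C"] simp: nt_comp_def nt_id_def)

lemma nt_map_comp:
  assumes "is_functor C C K" "\<alpha> \<in> nat_trans C C H I" "\<beta> \<in> nat_trans C C I J"
  shows "nt_map C K (\<beta> \<bullet>\<^bsub>C\<^esub> \<alpha>) = nt_map C K \<beta> \<bullet>\<^bsub>C\<^esub> nt_map C K \<alpha>"
  using is_functorD(6)[OF assms(1) nat_transD(2)[OF assms(2)] nat_transD(2)[OF assms(3)]]
  by (auto simp: nt_comp_def nt_map_def)

text \<open>This is naturality of \<open>\<beta>\<close> at the morphism \<open>\<alpha> X\<close>.
  It is applied with \<open>\<beta>\<close> equal to the counit or the comultiplication, to move
  these past a whiskered transformation.\<close>

lemma nt_interchange:
  assumes "is_functor C C H" "is_functor C C I" "\<alpha> \<in> nat_trans C C H I" "\<beta> \<in> nat_trans C C J K"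
  shows "nt_at C \<beta> I \<bullet>\<^bsub>C\<^esub> nt_map C J \<alpha> = nt_map C K \<alpha> \<bullet>\<^bsub>C\<^esub> nt_at C \<beta> H"
  using nat_transD(3)[OF assms(4) nat_transD(2)[OF assms(3)]]
  by (auto simp: nt_comp_def nt_map_def nt_at_def)

end

section \<open>Homomorphisms into abelian groups and their equalizers\<close>

lemma (in comm_group) subgroup_comm_group:
  assumes "subgroup H G"
  shows "comm_group (G\<lparr>carrier := H\<rparr>)"
  using assms m_comm subgroup.mem_carrier[OF assms]
  by (intro group.group_comm_groupI[OF subgroup_imp_group]) auto

lemma hom_mult_inv:
  assumes "group G" "group H" "f \<in> hom G H" "a \<in> carrier G" "b \<in> carrier G"
  shows "f (a \<otimes>\<^bsub>G\<^esub> inv\<^bsub>G\<^esub> b) = f a \<otimes>\<^bsub>H\<^esub> inv\<^bsub>H\<^esub> (f b)"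
proof -
  interpret group_hom G H f using assms by (simp add: group_hom_def group_hom_axioms_def)
  show ?thesis using assms by simp
qed

text \<open>Commutativity of \<open>H\<close> interchanges the two middle factors. In this way the
  right-hand sides of the Leibniz rule and of the cointegration equation become
  homomorphisms.\<close>

lemma hom_mult_hom:
  assumes "comm_group H" "f \<in> hom G H" "g \<in> hom G H"
  shows "(\<lambda>x. f x \<otimes>\<^bsub>H\<^esub> g x) \<in> hom G H"
proof -
  interpret comm_group H by fact
  show ?thesis using assms(2,3) by (auto simp: hom_def Pi_def m_ac)
qed

lemma hom_mult_inv_hom:
  assumes "comm_group H" "f \<in> hom G H" "g \<in> hom G H"
  shows "(\<lambda>x. f x \<otimes>\<^bsub>H\<^esub> inv\<^bsub>H\<^esub> (g x)) \<in> hom G H"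
proof -
  interpret comm_group H by fact
  show ?thesis using assms(2,3) by (auto simp: hom_def Pi_def m_ac inv_mult)
qed

text \<open>The defining equations of coderivations and cointegrations each equate two additive
  maps, so each of them cuts out a subgroup.\<close>

lemma subgroup_equalizer:
  assumes "group G" "group H" "f \<in> hom G H" "g \<in> hom G H"
  shows "subgroup {x \<in> carrier G. f x = g x} G"
proof -
  interpret f: group_hom G H f using assms by (simp add: group_hom_def group_hom_axioms_def)
  interpret g: group_hom G H g using assms by (simp add: group_hom_def group_hom_axioms_def)
  show ?thesis by (rule f.G.subgroupI) (auto intro!: exI[of _ "\<one>\<^bsub>G\<^esub>"])
qed

section \<open>The abelian group of natural transformations\<close>

context preadditive_category
begin

lemma hom_group_simps [simp]:
  "carrier (hom_group A X Y) = mor A X Y" "a \<otimes>\<^bsub>hom_group A X Y\<^esub> b = Add A a b"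
  "\<one>\<^bsub>hom_group A X Y\<^esub> = Zer A X Y"
  by (simp_all add: hom_group_def)

lemma Cmp_left_hom:
  assumes "g \<in> mor A Y Z"
  shows "(\<lambda>f. g \<cdot> f) \<in> hom (hom_group A X Y) (hom_group A X Z)"
  using assms by (auto simp: hom_def Cmp_mor Cmp_Add_right)

lemma Cmp_right_hom:
  assumes "f \<in> mor A X Y"
  shows "(\<lambda>g. g \<cdot> f) \<in> hom (hom_group A Y Z) (hom_group A X Z)"
  using assms by (auto simp: hom_def Cmp_mor Cmp_Add_left)

text \<open>As a \<open>group_hom\<close>, composition with a fixed morphism preserves zero and
  negatives; this gives naturality of the zero family and of componentwise negatives below.\<close>

lemma group_hom_Cmp_left:
  assumes "X \<in> Ob A" "g \<in> mor A Y Z"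
  shows "group_hom (hom_group A X Y) (hom_group A X Z) (\<lambda>f. g \<cdot> f)"
  using assms mor_ArD[OF assms(2)] hom_comm_group Cmp_left_hom
  by (auto simp: group_hom_def group_hom_axioms_def comm_group_def)

lemma group_hom_Cmp_right:
  assumes "Z \<in> Ob A" "f \<in> mor A X Y"
  shows "group_hom (hom_group A Y Z) (hom_group A X Z) (\<lambda>g. g \<cdot> f)"
  using assms mor_ArD[OF assms(2)] hom_comm_group Cmp_right_hom
  by (auto simp: group_hom_def group_hom_axioms_def comm_group_def)

lemma nt_group_simps [simp]:
  "carrier (nt_group A H I) = nat_trans A A H I" "a \<otimes>\<^bsub>nt_group A H I\<^esub> b = nt_add A a b"
  by (simp_all add: nt_group_def)

text \<open>The structure is taken componentwise from the hom-groups; bilinearity of composition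
  makes sums, zero and negatives natural again.\<close>

lemma comm_group_nt_group:
  assumes H: "is_functor A A H" and I: "is_functor A A I"
  shows "comm_group (nt_group A H I)"
proof -
  let ?G = "\<lambda>X Y. hom_group A (OMap H X) (OMap I Y)"
  have G: "comm_group (?G X Y)" if "X \<in> Ob A" "Y \<in> Ob A" for X Y
    using that H I by (intro hom_comm_group is_functorD(3))
  have add: "Add A a b \<in> mor A (OMap H X) (OMap I X)"
    if "a \<in> mor A (OMap H X) (OMap I X)" "b \<in> mor A (OMap H X) (OMap I X)" "X \<in> Ob A" for a b X
    using comm_groupE(1)[OF G[OF that(3,3)]] that by simp
  have closed: "nt_add A \<alpha> \<beta> \<in> nat_trans A A H I"
    if \<alpha>: "\<alpha> \<in> nat_trans A A H I" and \<beta>: "\<beta> \<in> nat_trans A A H I" for \<alpha> \<beta>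
  proof (rule nat_transI)
    fix X Y f assume f: "f \<in> mor A X Y"
    note XY = mor_ArD(4,5)[OF f]
    show "nt_add A \<alpha> \<beta> Y \<cdot> AMap H f = AMap I f \<cdot> nt_add A \<alpha> \<beta> X"
      using Cmp_Add_left[OF is_functorD(4)[OF H f] nat_transD(2)[OF \<alpha> XY(2)] nat_transD(2)[OF \<beta> XY(2)]]
        Cmp_Add_right[OF nat_transD(2)[OF \<alpha> XY(1)] nat_transD(2)[OF \<beta> XY(1)] is_functorD(4)[OF I f]]
        nat_transD(3)[OF \<alpha> f] nat_transD(3)[OF \<beta> f] XY
      by (simp add: nt_add_def)
  qed (use \<alpha> \<beta> in \<open>auto simp: nt_add_def nat_transD intro!: add\<close>)
  define z where "z = (\<lambda>X\<in>Ob A. Zer A (OMap H X) (OMap I X))"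
  have z: "z \<in> nat_trans A A H I"
  proof (rule nat_transI)
    fix X Y f assume f: "f \<in> mor A X Y"
    note XY = mor_ArD(4,5)[OF f]
    show "z Y \<cdot> AMap H f = AMap I f \<cdot> z X"
      using group_hom.hom_one[OF group_hom_Cmp_left[OF is_functorD(3)[OF H XY(1)] is_functorD(4)[OF I f]]]
        group_hom.hom_one[OF group_hom_Cmp_right[OF is_functorD(3)[OF I XY(2)] is_functorD(4)[OF H f]]] XY
      by (simp add: z_def)
  qed (use comm_groupE(2)[OF G] in \<open>auto simp: z_def\<close>)
  have inverse: "\<exists>\<beta>\<in>nat_trans A A H I. nt_add A \<beta> \<alpha> = z"
    if \<alpha>: "\<alpha> \<in> nat_trans A A H I" for \<alpha>
  proof (rule bexI)
    let ?\<beta> = "\<lambda>X\<in>Ob A. inv\<^bsub>?G X X\<^esub> (\<alpha> X)"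
    have inv_mor: "inv\<^bsub>?G X X\<^esub> (\<alpha> X) \<in> mor A (OMap H X) (OMap I X)" if "X \<in> Ob A" for X
      using group.inv_closed[OF comm_group.axioms(2)[OF G[OF that that]]] nat_transD(2)[OF \<alpha> that]
      by simp
    show "?\<beta> \<in> nat_trans A A H I"
    proof (rule nat_transI)
      fix X Y f assume f: "f \<in> mor A X Y"
      note XY = mor_ArD(4,5)[OF f]
      show "?\<beta> Y \<cdot> AMap H f = AMap I f \<cdot> ?\<beta> X"
        using group_hom.hom_inv[OF group_hom_Cmp_left[OF is_functorD(3)[OF H XY(1)] is_functorD(4)[OF I f]]]
          group_hom.hom_inv[OF group_hom_Cmp_right[OF is_functorD(3)[OF I XY(2)] is_functorD(4)[OF H f]]]
          nat_transD(2,3)[OF \<alpha>] f XY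
        by simp
    qed (use inv_mor in auto)
    show "nt_add A ?\<beta> \<alpha> = z"
      using group.l_inv[OF comm_group.axioms(2)[OF G]] nat_transD(2)[OF \<alpha>]
      by (auto simp: nt_add_def z_def)
  qed
  have unit: "nt_add A z \<alpha> = \<alpha>" if \<alpha>: "\<alpha> \<in> nat_trans A A H I" for \<alpha>
    using comm_groupE(5)[OF G] nat_transD(2)[OF \<alpha>]
    by (intro nat_trans_eqI[OF closed[OF z \<alpha>] \<alpha>]) (auto simp: nt_add_def z_def)
  show ?thesis
  proof (rule comm_groupI, goal_cases)
    \<comment> \<open>Cases 3 and 4 of \<open>comm_groupI\<close> are associativity and
      commutativity, which hold at each component; the other axioms were prepared above.\<close>
    case (3 \<alpha> \<beta> \<gamma>)
    then show ?case using comm_groupE(3)[OF G] by (auto simp: nt_add_def nat_transD)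
  next
    case (4 \<alpha> \<beta>)
    then show ?case using comm_groupE(4)[OF G] by (auto simp: nt_add_def nat_transD)
  qed (use closed z inverse unit in \<open>auto simp: nt_group_def simp flip: z_def\<close>)
qed

lemma group_nt_group: "is_functor A A H \<Longrightarrow> is_functor A A I \<Longrightarrow> group (nt_group A H I)"
  by (simp add: comm_group_nt_group comm_group.axioms)

text \<open>\<open>nt_diff\<close> negates \<open>\<beta> X\<close> in the hom-group read off from
  its own domain and codomain. These are \<open>OMap H X\<close> and \<open>OMap I X\<close>, and
  inverses are unique, so the componentwise difference is subtraction in
  \<open>nt_group\<close>.\<close>

lemma nt_diff_eq:
  assumes "is_functor A A H" "is_functor A A I"
    and "\<alpha> \<in> nat_trans A A H I" and \<beta>: "\<beta> \<in> nat_trans A A H I"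
  shows "nt_diff A \<alpha> \<beta> = nt_add A \<alpha> (inv\<^bsub>nt_group A H I\<^esub> \<beta>)"
proof -
  interpret N: comm_group "nt_group A H I" using assms by (intro comm_group_nt_group)
  let ?i = "inv\<^bsub>nt_group A H I\<^esub> \<beta>"
  have i: "?i \<in> nat_trans A A H I" using N.inv_closed \<beta> by simp
  have "inv\<^bsub>hom_group A (OMap H X) (OMap I X)\<^esub> (\<beta> X) = ?i X" if X: "X \<in> Ob A" for X
  proof -
    interpret comm_group "hom_group A (OMap H X) (OMap I X)"
      using X assms by (intro hom_comm_group is_functorD(3))
    have "nt_add A ?i \<beta> X = Zer A (OMap H X) (OMap I X)"
      using N.l_inv[of \<beta>] \<beta> X by (simp add: nt_group_def)
    then show ?thesis
      using X nat_transD(2)[OF \<beta> X] nat_transD(2)[OF i X] by (intro inv_equality) (auto simp: nt_add_def)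
  qed
  then show ?thesis
    using nat_transD(2)[OF \<beta>] by (auto simp: nt_diff_def nt_add_def mor_def)
qed

lemma nt_comp_left_hom:
  assumes "is_functor A A H" "is_functor A A I" "is_functor A A J" "\<beta> \<in> nat_trans A A I J"
  shows "(\<lambda>\<alpha>. \<beta> \<bullet>\<^bsub>A\<^esub> \<alpha>) \<in> hom (nt_group A H I) (nt_group A H J)"
proof (rule homI)
  fix \<alpha> \<alpha>' assume "\<alpha> \<in> carrier (nt_group A H I)" "\<alpha>' \<in> carrier (nt_group A H I)"
  then have "\<beta> X \<cdot> Add A (\<alpha> X) (\<alpha>' X) = Add A (\<beta> X \<cdot> \<alpha> X) (\<beta> X \<cdot> \<alpha>' X)" if "X \<in> Ob A" for X
    using Cmp_Add_right[OF nat_transD(2) nat_transD(2) nat_transD(2)[OF assms(4)]] that by simp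
  then show "\<beta> \<bullet>\<^bsub>A\<^esub> (\<alpha> \<otimes>\<^bsub>nt_group A H I\<^esub> \<alpha>') = (\<beta> \<bullet>\<^bsub>A\<^esub> \<alpha>) \<otimes>\<^bsub>nt_group A H J\<^esub> (\<beta> \<bullet>\<^bsub>A\<^esub> \<alpha>')"
    by (auto simp: nt_comp_def nt_add_def)
qed (use assms nt_comp_nat_trans in simp)

lemma nt_comp_right_hom:
  assumes "is_functor A A H" "is_functor A A I" "is_functor A A J" "\<alpha> \<in> nat_trans A A H I"
  shows "(\<lambda>\<beta>. \<beta> \<bullet>\<^bsub>A\<^esub> \<alpha>) \<in> hom (nt_group A I J) (nt_group A H J)"
proof (rule homI)
  fix \<beta> \<beta>' assume "\<beta> \<in> carrier (nt_group A I J)" "\<beta>' \<in> carrier (nt_group A I J)"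
  then have "Add A (\<beta> X) (\<beta>' X) \<cdot> \<alpha> X = Add A (\<beta> X \<cdot> \<alpha> X) (\<beta>' X \<cdot> \<alpha> X)" if "X \<in> Ob A" for X
    using Cmp_Add_left[OF nat_transD(2)[OF assms(4)] nat_transD(2) nat_transD(2)] that by simp
  then show "(\<beta> \<otimes>\<^bsub>nt_group A I J\<^esub> \<beta>') \<bullet>\<^bsub>A\<^esub> \<alpha> = (\<beta> \<bullet>\<^bsub>A\<^esub> \<alpha>) \<otimes>\<^bsub>nt_group A H J\<^esub> (\<beta>' \<bullet>\<^bsub>A\<^esub> \<alpha>)"
    by (auto simp: nt_comp_def nt_add_def)
qed (use assms nt_comp_nat_trans in simp)

lemma nt_at_hom:
  assumes "is_functor A A K"
  shows "(\<lambda>\<alpha>. nt_at A \<alpha> K) \<in> hom (nt_group A H I) (nt_group A (H \<odot> K) (I \<odot> K))"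
  by (rule homI) (use assms nt_at_nat_trans nt_at_add in auto)

text \<open>Additivity of \<open>K\<close> enters here, since \<open>K\<close> has to preserve the
  sums formed at the components.\<close>

lemma nt_map_hom:
  assumes "is_functor A A H" "is_functor A A I" and K: "additive_endofunctor A K"
  shows "(\<lambda>\<alpha>. nt_map A K \<alpha>) \<in> hom (nt_group A H I) (nt_group A (K \<odot> H) (K \<odot> I))"
proof (rule homI)
  fix \<alpha> \<beta> assume "\<alpha> \<in> carrier (nt_group A H I)" "\<beta> \<in> carrier (nt_group A H I)"
  then have "AMap K (Add A (\<alpha> X) (\<beta> X)) = Add A (AMap K (\<alpha> X)) (AMap K (\<beta> X))" if "X \<in> Ob A" for X
    using K nat_transD(2)[OF _ that] unfolding additive_endofunctor_def nt_group_simps by blast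
  then show "nt_map A K (\<alpha> \<otimes>\<^bsub>nt_group A H I\<^esub> \<beta>)
      = nt_map A K \<alpha> \<otimes>\<^bsub>nt_group A (K \<odot> H) (K \<odot> I)\<^esub> nt_map A K \<beta>"
    by (auto simp: nt_map_def nt_add_def)
qed (use assms nt_map_nat_trans in \<open>auto simp: additive_endofunctor_def\<close>)

end

section \<open>Coderivations and cointegrations\<close>

lemma (in category) endofunctor_comp_fun [simp]:
  "is_functor C C H \<Longrightarrow> is_functor C C I \<Longrightarrow> is_functor C C (H \<odot> I)"
  by (rule is_functor_comp_fun)

section \<open>Additive comonads and their counit laws\<close>

locale additive_comonad = preadditive_category A
  for A :: "('o, 'm, 'z) acat_scheme" (structure) +
  fixes F :: "('o, 'm, 'o, 'm) cfun" and \<delta> \<xi> :: "'o \<Rightarrow> 'm"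
  assumes comonad: "comonad A F \<delta> \<xi>"
begin

lemma additive_F: "additive_endofunctor A F"
  using comonad by (simp add: comonad_def)

lemma functor_F [simp]: "is_functor A A F"
  using additive_F by (simp add: additive_endofunctor_def)

declare is_functor_id_fun [simp]

lemma \<delta>_nat: "\<delta> \<in> nat_trans A A F (F \<odot> F)"
  and \<xi>_nat: "\<xi> \<in> nat_trans A A F id_fun"
  and F\<xi>_\<delta>: "nt_map A F \<xi> \<bullet>\<^bsub>A\<^esub> \<delta> = nt_id A F"
  and \<xi>F_\<delta>: "nt_at A \<xi> F \<bullet>\<^bsub>A\<^esub> \<delta> = nt_id A F"
  using comonad by (simp_all add: comonad_def)

text \<open>Iterated composites are bracketed to the right; composition of functors is associative
  on the nose, so this is a mere rewriting.\<close>

lemma \<delta>_at_nat: "is_functor A A I \<Longrightarrow> nt_at A \<delta> I \<in> nat_trans A A (F \<odot> I) (F \<odot> (F \<odot> I))"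
  using nt_at_nat_trans[OF _ \<delta>_nat] by (simp add: comp_fun_assoc)

lemma \<xi>_at_nat: "is_functor A A I \<Longrightarrow> nt_at A \<xi> I \<in> nat_trans A A (F \<odot> I) I"
  using nt_at_nat_trans[OF _ \<xi>_nat] by simp

text \<open>The counit law for \<open>\<xi>\<^sub>F\<close> is evaluated at \<open>I\<close>:
  \<open>nt_at_at\<close> and \<open>nt_at_comp\<close>, read backwards, pull \<open>I\<close>
  outside so that the law applies.\<close>

lemma \<xi>_at_\<delta>_at:
  assumes "is_functor A A I" "h \<in> nat_trans A A H (F \<odot> I)"
  shows "nt_at A \<xi> (F \<odot> I) \<bullet>\<^bsub>A\<^esub> (nt_at A \<delta> I \<bullet>\<^bsub>A\<^esub> h) = h"
proof -
  have "nt_at A \<xi> (F \<odot> I) \<bullet>\<^bsub>A\<^esub> nt_at A \<delta> I = nt_id A (F \<odot> I)"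
    using \<xi>F_\<delta> assms(1) by (simp add: nt_at_nt_id flip: nt_at_at nt_at_comp)
  then show ?thesis
    using nt_comp_assoc[OF assms(2) \<delta>_at_nat \<xi>_at_nat] nt_comp_id(2)[OF assms(2)] assms(1) by simp
qed

text \<open>The other counit law, evaluated at \<open>I\<close> in the same way. In
  \<open>lift_\<xi>\<close> it recovers a left comodule map from its composite with the
  counit.\<close>

lemma F\<xi>_at_\<delta>_at:
  assumes "is_functor A A I" "h \<in> nat_trans A A H (F \<odot> I)"
  shows "nt_map A F (nt_at A \<xi> I) \<bullet>\<^bsub>A\<^esub> (nt_at A \<delta> I \<bullet>\<^bsub>A\<^esub> h) = h"
proof -
  have "nt_map A F (nt_at A \<xi> I) \<bullet>\<^bsub>A\<^esub> nt_at A \<delta> I = nt_id A (F \<odot> I)"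
    using F\<xi>_\<delta> assms(1) by (simp add: nt_at_nt_id flip: nt_at_map nt_at_comp)
  then show ?thesis
    using nt_comp_assoc[OF assms(2) \<delta>_at_nat nt_map_nat_trans[OF _ _ _ \<xi>_at_nat, of _ F]]
      nt_comp_id(2)[OF assms(2)] assms(1) by simp
qed

end

section \<open>Lifting along the two coactions of a bicomodule\<close>

locale comonad_bicomodule = additive_comonad A F \<delta> \<xi>
  for A :: "('o, 'm, 'z) acat_scheme" (structure) and F \<delta> \<xi> +
  fixes U :: "'u itself" and M :: "('o, 'm, 'o, 'm) cfun" and m n :: "'o \<Rightarrow> 'm"
  assumes bicomodule: "bicomodule U A F \<delta> \<xi> (M, m, n)"
begin

lemma functor_M [simp]: "is_functor A A M"
  using bicomodule by (simp add: additive_endofunctor_def)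

lemma m_nat: "m \<in> nat_trans A A M (F \<odot> M)"
  and n_nat: "n \<in> nat_trans A A M (M \<odot> F)"
  and \<delta>M_m: "nt_at A \<delta> M \<bullet>\<^bsub>A\<^esub> m = nt_map A F m \<bullet>\<^bsub>A\<^esub> m"
  and \<xi>M_m: "nt_at A \<xi> M \<bullet>\<^bsub>A\<^esub> m = nt_id A M"
  and mF_n: "nt_at A m F \<bullet>\<^bsub>A\<^esub> n = nt_map A F n \<bullet>\<^bsub>A\<^esub> m"
  using bicomodule by simp_all

text \<open>For \<open>\<theta>\<close> from \<open>M\<close> to \<open>I\<close> this is the
  corresponding left comodule map into the cofree comodule on \<open>I\<close>.\<close>

abbreviation lift :: "('o \<Rightarrow> 'm) \<Rightarrow> 'o \<Rightarrow> 'm" where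
  "lift \<theta> \<equiv> nt_map A F \<theta> \<bullet>\<^bsub>A\<^esub> m"

text \<open>The counterpart for the right coaction. The two terms of the Leibniz rule for
  \<open>g\<close> are \<open>lift g\<close> and \<open>rlift g\<close>.\<close>

abbreviation rlift :: "('o \<Rightarrow> 'm) \<Rightarrow> 'o \<Rightarrow> 'm" where
  "rlift \<theta> \<equiv> nt_at A \<theta> F \<bullet>\<^bsub>A\<^esub> n"

context
  fixes I :: "('o, 'm, 'o, 'm) cfun"
  assumes I [simp]: "is_functor A A I"
begin

text \<open>Both stages of lifting are additive: whiskering because \<open>F\<close> is additive,
  precomposition with \<open>m\<close> by bilinearity. The general \<open>I\<close> is later taken
  to be \<open>id_fun\<close>, \<open>F\<close> or \<open>F \<odot> F\<close>.\<close>

lemma lift_hom: "lift \<in> hom (nt_group A M I) (nt_group A M (F \<odot> I))"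
  using hom_compose[OF nt_map_hom[OF functor_M I additive_F] nt_comp_right_hom[OF _ _ _ m_nat]]
  by (simp add: comp_def)

lemma rlift_hom: "rlift \<in> hom (nt_group A M I) (nt_group A M (I \<odot> F))"
  using hom_compose[OF nt_at_hom[OF functor_F] nt_comp_right_hom[OF _ _ _ n_nat]]
  by (simp add: comp_def)

lemma lift_nat: "\<theta> \<in> nat_trans A A M I \<Longrightarrow> lift \<theta> \<in> nat_trans A A M (F \<odot> I)"
  using hom_in_carrier[OF lift_hom] by simp

lemma rlift_nat: "\<theta> \<in> nat_trans A A M I \<Longrightarrow> rlift \<theta> \<in> nat_trans A A M (I \<odot> F)"
  using hom_in_carrier[OF rlift_hom] by simp

lemma map_nat: "\<theta> \<in> nat_trans A A M I \<Longrightarrow> nt_map A F \<theta> \<in> nat_trans A A (F \<odot> M) (F \<odot> I)"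
  by (simp add: nt_map_nat_trans)

text \<open>Naturality of \<open>\<xi>\<close> moves \<open>\<theta>\<close> to the left and leaves
  \<open>\<xi>\<^sub>M \<circ> m\<close>, which is the identity by the counit law of the left
  coaction.\<close>

lemma \<xi>_lift:
  assumes "\<theta> \<in> nat_trans A A M I"
  shows "nt_at A \<xi> I \<bullet>\<^bsub>A\<^esub> lift \<theta> = \<theta>"
proof -
  have "nt_at A \<xi> I \<bullet>\<^bsub>A\<^esub> lift \<theta> = nt_at A \<xi> I \<bullet>\<^bsub>A\<^esub> nt_map A F \<theta> \<bullet>\<^bsub>A\<^esub> m"
    using nt_comp_assoc[OF m_nat map_nat[OF assms] \<xi>_at_nat] by simp
  also have "nt_at A \<xi> I \<bullet>\<^bsub>A\<^esub> nt_map A F \<theta> = nt_map A id_fun \<theta> \<bullet>\<^bsub>A\<^esub> nt_at A \<xi> M"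
    using nt_interchange[OF _ _ assms \<xi>_nat] by simp
  also have "nt_map A id_fun \<theta> = \<theta>"
    using nt_map_id_fun[OF assms] .
  finally show ?thesis
    using nt_comp_assoc[OF m_nat \<xi>_at_nat assms] \<xi>M_m nt_comp_id(1)[OF assms] by simp
qed

text \<open>Every lift is a left comodule map into \<open>F \<odot> I\<close>: naturality of
  \<open>\<delta>\<close> takes it past \<open>F\<theta>\<close>, and coassociativity of
  \<open>m\<close> does the rest.\<close>

lemma \<delta>_lift:
  assumes "\<theta> \<in> nat_trans A A M I"
  shows "nt_at A \<delta> I \<bullet>\<^bsub>A\<^esub> lift \<theta> = lift (lift \<theta>)"
proof -
  have FF: "nt_map A F (nt_map A F \<theta>) \<in> nat_trans A A (F \<odot> (F \<odot> M)) (F \<odot> (F \<odot> I))"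
    using map_nat[OF assms] by (simp add: nt_map_nat_trans)
  have Fm: "nt_map A F m \<in> nat_trans A A (F \<odot> M) (F \<odot> (F \<odot> M))"
    using m_nat by (simp add: nt_map_nat_trans)
  have "nt_at A \<delta> I \<bullet>\<^bsub>A\<^esub> lift \<theta> = nt_at A \<delta> I \<bullet>\<^bsub>A\<^esub> nt_map A F \<theta> \<bullet>\<^bsub>A\<^esub> m"
    using nt_comp_assoc[OF m_nat map_nat[OF assms] \<delta>_at_nat] by simp
  also have "nt_at A \<delta> I \<bullet>\<^bsub>A\<^esub> nt_map A F \<theta> = nt_map A F (nt_map A F \<theta>) \<bullet>\<^bsub>A\<^esub> nt_at A \<delta> M"
    using nt_interchange[OF _ _ assms \<delta>_nat] by (simp add: nt_map_map)
  also have "\<dots> \<bullet>\<^bsub>A\<^esub> m = nt_map A F (nt_map A F \<theta>) \<bullet>\<^bsub>A\<^esub> nt_map A F m \<bullet>\<^bsub>A\<^esub> m"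
    using nt_comp_assoc[OF m_nat \<delta>_at_nat FF] nt_comp_assoc[OF m_nat Fm FF] \<delta>M_m by simp
  also have "\<dots> = lift (lift \<theta>)"
    using nt_map_comp[OF _ m_nat map_nat[OF assms]] by simp
  finally show ?thesis .
qed

text \<open>The second assumption says that \<open>h\<close> is a left comodule map. It lets
  \<open>lift h\<close> be replaced by \<open>\<delta>\<^sub>I \<circ> h\<close>, after which the
  counit law cancels the comultiplication.\<close>

lemma lift_\<xi>:
  assumes h: "h \<in> nat_trans A A M (F \<odot> I)" and "nt_at A \<delta> I \<bullet>\<^bsub>A\<^esub> h = lift h"
  shows "lift (nt_at A \<xi> I \<bullet>\<^bsub>A\<^esub> h) = h"
proof -
  have "lift (nt_at A \<xi> I \<bullet>\<^bsub>A\<^esub> h) = nt_map A F (nt_at A \<xi> I) \<bullet>\<^bsub>A\<^esub> nt_map A F h \<bullet>\<^bsub>A\<^esub> m"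
    using nt_map_comp[OF _ h \<xi>_at_nat] by simp
  also have "\<dots> = nt_map A F (nt_at A \<xi> I) \<bullet>\<^bsub>A\<^esub> lift h"
    using nt_comp_assoc[OF m_nat nt_map_nat_trans[OF _ _ _ h] nt_map_nat_trans[OF _ _ _ \<xi>_at_nat]]
    by simp
  also have "\<dots> = h"
    using F\<xi>_at_\<delta>_at[OF I h] assms(2) by simp
  finally show ?thesis .
qed

lemma rlift_comp:
  assumes "is_functor A A J" "h \<in> nat_trans A A M I" "\<beta> \<in> nat_trans A A I J"
  shows "nt_at A \<beta> F \<bullet>\<^bsub>A\<^esub> rlift h = rlift (\<beta> \<bullet>\<^bsub>A\<^esub> h)"
  using nt_comp_assoc[OF n_nat nt_at_nat_trans[OF _ assms(2)] nt_at_nat_trans[OF _ assms(3)]]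
  by (simp add: nt_at_comp)

lemma lift_comp:
  assumes "is_functor A A J" "h \<in> nat_trans A A M I" "\<beta> \<in> nat_trans A A I J"
  shows "nt_map A F \<beta> \<bullet>\<^bsub>A\<^esub> lift h = lift (\<beta> \<bullet>\<^bsub>A\<^esub> h)"
  using nt_comp_assoc[OF m_nat nt_map_nat_trans[OF _ _ _ assms(2)] nt_map_nat_trans[OF _ _ _ assms(3)]]
    nt_map_comp[OF _ assms(2,3)] assms(1) by simp

text \<open>The reason is the compatibility \<open>mF_n\<close> of the two coactions, together with
  the fact that whiskerings by \<open>F\<close> on the two sides commute.\<close>

lemma lift_rlift:
  assumes "\<theta> \<in> nat_trans A A M I"
  shows "lift (rlift \<theta>) = rlift (lift \<theta>)"
proof -
  have \<theta>F: "nt_at A \<theta> F \<in> nat_trans A A (M \<odot> F) (I \<odot> F)"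
    using assms by (simp add: nt_at_nat_trans)
  have F\<theta>F: "nt_map A F (nt_at A \<theta> F) \<in> nat_trans A A (F \<odot> (M \<odot> F)) (F \<odot> (I \<odot> F))"
    using \<theta>F by (simp add: nt_map_nat_trans)
  have mF: "nt_at A m F \<in> nat_trans A A (M \<odot> F) (F \<odot> (M \<odot> F))"
    using nt_at_nat_trans[OF functor_F m_nat] by (simp add: comp_fun_assoc)
  have Fn: "nt_map A F n \<in> nat_trans A A (F \<odot> M) (F \<odot> (M \<odot> F))"
    using n_nat by (simp add: nt_map_nat_trans)
  have "lift (rlift \<theta>) = nt_map A F (nt_at A \<theta> F) \<bullet>\<^bsub>A\<^esub> (nt_map A F n \<bullet>\<^bsub>A\<^esub> m)"
    using nt_comp_assoc[OF m_nat Fn F\<theta>F] nt_map_comp[OF _ n_nat \<theta>F] by simp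
  also have "\<dots> = nt_map A F (nt_at A \<theta> F) \<bullet>\<^bsub>A\<^esub> nt_at A m F \<bullet>\<^bsub>A\<^esub> n"
    using nt_comp_assoc[OF n_nat mF F\<theta>F] mF_n by simp
  also have "\<dots> = rlift (lift \<theta>)"
    by (simp add: nt_at_comp nt_at_map)
  finally show ?thesis .
qed

end

section \<open>The isomorphism between cointegrations and coderivations\<close>

abbreviation coint_to_coder :: "('o \<Rightarrow> 'm) \<Rightarrow> 'o \<Rightarrow> 'm" where
  "coint_to_coder h \<equiv> nt_at A \<xi> F \<bullet>\<^bsub>A\<^esub> h"

abbreviation coint where "coint \<equiv> Coint A F \<delta> (M, m, n) (F, \<delta>, \<delta>)"
abbreviation coder where "coder \<equiv> Coder A F \<delta> (M, m, n)"
abbreviation incoint where "incoint \<equiv> InCoint A F \<delta> (M, m, n) (F, \<delta>, \<delta>)"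
abbreviation incoder where "incoder \<equiv> InCoder A F \<delta> (M, m, n)"

lemma coder_iff:
  "g \<in> carrier coder \<longleftrightarrow> g \<in> nat_trans A A M F \<and> \<delta> \<bullet>\<^bsub>A\<^esub> g = nt_add A (lift g) (rlift g)"
  by simp

text \<open>With \<open>F\<close> as target both coactions are \<open>\<delta>\<close>. The first
  equation makes \<open>h\<close> a left comodule map into \<open>F \<odot> F\<close>, as
  \<open>lift_\<xi>\<close> requires at \<open>I = F\<close>; the second is matched with the Leibniz
  rule.\<close>

lemma coint_iff:
  "h \<in> carrier coint \<longleftrightarrow> h \<in> nat_trans A A M (F \<odot> F) \<and> nt_at A \<delta> F \<bullet>\<^bsub>A\<^esub> h = lift h \<and>
     nt_map A F \<delta> \<bullet>\<^bsub>A\<^esub> h = nt_add A (nt_at A \<delta> F \<bullet>\<^bsub>A\<^esub> h) (rlift h)"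
  by simp

lemma coder_eq: "coder = (nt_group A M F)\<lparr>carrier := carrier coder\<rparr>"
  and coint_eq: "coint = (nt_group A M (F \<odot> F))\<lparr>carrier := carrier coint\<rparr>"
  by simp_all

lemma F\<delta>_nat: "nt_map A F \<delta> \<in> nat_trans A A (F \<odot> F) (F \<odot> (F \<odot> F))"
  using \<delta>_nat by (simp add: nt_map_nat_trans)

text \<open>Coderivations form the equalizer of two homomorphisms: composition with
  \<open>\<delta>\<close>, and the pointwise sum of \<open>lift\<close> and
  \<open>rlift\<close>.\<close>

lemma subgroup_coder: "subgroup (carrier coder) (nt_group A M F)"
proof -
  have "(\<lambda>g. lift g \<otimes>\<^bsub>nt_group A M (F \<odot> F)\<^esub> rlift g) \<in> hom (nt_group A M F) (nt_group A M (F \<odot> F))"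
    by (intro hom_mult_hom comm_group_nt_group lift_hom rlift_hom) simp_all
  from subgroup_equalizer[OF _ _ nt_comp_left_hom[OF _ _ _ \<delta>_nat] this]
  show ?thesis
    by (simp add: group_nt_group)
qed

text \<open>Two equalizers are intersected, one for each defining equation.\<close>

lemma subgroup_coint: "subgroup (carrier coint) (nt_group A M (F \<odot> F))"
proof -
  let ?G = "nt_group A M (F \<odot> F)" and ?H = "nt_group A M (F \<odot> (F \<odot> F))"
  interpret group ?G by (simp add: group_nt_group)
  have grp: "group ?G" "group ?H" by (simp_all add: group_nt_group)
  have \<delta>F: "(\<lambda>h. nt_at A \<delta> F \<bullet>\<^bsub>A\<^esub> h) \<in> hom ?G ?H"
    by (simp add: nt_comp_left_hom[OF _ _ _ \<delta>_at_nat])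
  have "rlift \<in> hom ?G ?H"
    using rlift_hom[of "F \<odot> F"] by (simp add: comp_fun_assoc)
  then have sum: "(\<lambda>h. (nt_at A \<delta> F \<bullet>\<^bsub>A\<^esub> h) \<otimes>\<^bsub>?H\<^esub> rlift h) \<in> hom ?G ?H"
    by (intro hom_mult_hom comm_group_nt_group \<delta>F) simp_all
  have "subgroup ({h \<in> carrier ?G. nt_at A \<delta> F \<bullet>\<^bsub>A\<^esub> h = lift h} \<inter>
      {h \<in> carrier ?G. nt_map A F \<delta> \<bullet>\<^bsub>A\<^esub> h = (nt_at A \<delta> F \<bullet>\<^bsub>A\<^esub> h) \<otimes>\<^bsub>?H\<^esub> rlift h}) ?G"
    using subgroup_equalizer[OF grp \<delta>F lift_hom]
      subgroup_equalizer[OF grp nt_comp_left_hom[OF _ _ _ F\<delta>_nat] sum]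
    by (intro subgroups_Inter_pair) simp_all
  also have "{h \<in> carrier ?G. nt_at A \<delta> F \<bullet>\<^bsub>A\<^esub> h = lift h} \<inter>
      {h \<in> carrier ?G. nt_map A F \<delta> \<bullet>\<^bsub>A\<^esub> h = (nt_at A \<delta> F \<bullet>\<^bsub>A\<^esub> h) \<otimes>\<^bsub>?H\<^esub> rlift h} = carrier coint"
    by auto
  finally show ?thesis .
qed

lemma comm_group_coder: "comm_group coder"
  using comm_group.subgroup_comm_group[OF comm_group_nt_group subgroup_coder] coder_eq by simp

lemma comm_group_coint: "comm_group coint"
  using comm_group.subgroup_comm_group[OF comm_group_nt_group subgroup_coint] coint_eq by simp

lemma lift_coint_to_coder:
  assumes "h \<in> carrier coint"
  shows "lift (coint_to_coder h) = h"
  using assms lift_\<xi>[OF functor_F] by simp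

lemma coint_to_coder_lift:
  assumes "g \<in> nat_trans A A M F"
  shows "coint_to_coder (lift g) = g"
  using \<xi>_lift[OF functor_F assms] .

lemma coint_to_coder_nat:
  "h \<in> nat_trans A A M (F \<odot> F) \<Longrightarrow> coint_to_coder h \<in> nat_trans A A M F"
  using nt_comp_nat_trans[OF _ _ _ _ \<xi>_at_nat] by simp

lemma \<xi>_rlift:
  assumes "h \<in> nat_trans A A M (F \<odot> F)"
  shows "nt_at A \<xi> (F \<odot> F) \<bullet>\<^bsub>A\<^esub> rlift h = rlift (coint_to_coder h)"
  using rlift_comp[OF _ _ assms \<xi>_at_nat] by (simp add: nt_at_at)

text \<open>The second cointegration equation is composed with \<open>\<xi>\<close> at
  \<open>F \<odot> F\<close>: its left side turns into \<open>\<delta>\<close> after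
  \<open>coint_to_coder h\<close>, and its two summands into the two terms of the Leibniz
  rule.\<close>

lemma coint_to_coder_mem:
  assumes "h \<in> carrier coint"
  shows "coint_to_coder h \<in> carrier coder"
proof -
  note h = assms[unfolded coint_iff]
  note \<xi>FF = \<xi>_at_nat[of "F \<odot> F", simplified]
  have rl: "rlift h \<in> nat_trans A A M (F \<odot> (F \<odot> F))"
    using rlift_nat[of "F \<odot> F" h] h by (simp add: comp_fun_assoc)
  have \<delta>h: "nt_at A \<delta> F \<bullet>\<^bsub>A\<^esub> h \<in> nat_trans A A M (F \<odot> (F \<odot> F))"
    using h lift_nat[of "F \<odot> F" h] by simp
  have "\<delta> \<bullet>\<^bsub>A\<^esub> coint_to_coder h = \<delta> \<bullet>\<^bsub>A\<^esub> nt_at A \<xi> F \<bullet>\<^bsub>A\<^esub> h"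
    using nt_comp_assoc[OF conjunct1[OF h] \<xi>_at_nat \<delta>_nat] by simp
  \<comment> \<open>Naturality of \<open>\<xi>\<close> at the components of
    \<open>\<delta>\<close>.\<close>
  also have "\<delta> \<bullet>\<^bsub>A\<^esub> nt_at A \<xi> F = nt_at A \<xi> (F \<odot> F) \<bullet>\<^bsub>A\<^esub> nt_map A F \<delta>"
    using nt_interchange[OF _ _ \<delta>_nat \<xi>_nat] nt_map_id_fun[OF \<delta>_nat] by simp
  also have "\<dots> \<bullet>\<^bsub>A\<^esub> h = nt_at A \<xi> (F \<odot> F) \<bullet>\<^bsub>A\<^esub> nt_add A (nt_at A \<delta> F \<bullet>\<^bsub>A\<^esub> h) (rlift h)"
    using nt_comp_assoc[OF conjunct1[OF h] F\<delta>_nat \<xi>FF] h by simp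
  also have "\<dots> = nt_add A (nt_at A \<xi> (F \<odot> F) \<bullet>\<^bsub>A\<^esub> (nt_at A \<delta> F \<bullet>\<^bsub>A\<^esub> h))
      (nt_at A \<xi> (F \<odot> F) \<bullet>\<^bsub>A\<^esub> rlift h)"
    using hom_mult[OF nt_comp_left_hom[OF functor_M _ _ \<xi>FF]] \<delta>h rl by simp
  \<comment> \<open>The counit law reduces the first summand to \<open>h\<close>, which equals
    \<open>lift (coint_to_coder h)\<close> because \<open>h\<close> is a left comodule map.\<close>
  also have "\<dots> = nt_add A (lift (coint_to_coder h)) (rlift (coint_to_coder h))"
    using \<xi>_at_\<delta>_at[of F h M] \<xi>_rlift lift_coint_to_coder[OF assms] h by simp
  finally show ?thesis
    using coint_to_coder_nat h unfolding coder_iff by blast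
qed

text \<open>The first cointegration equation is \<open>\<delta>_lift\<close>. For the second,
  lifting the Leibniz rule of \<open>g\<close> gives the summands \<open>lift (lift g)\<close> and
  \<open>lift (rlift g)\<close>, which are \<open>\<delta>\<^sub>F \<circ> lift g\<close> and
  \<open>rlift (lift g)\<close>.\<close>

lemma lift_mem:
  assumes "g \<in> carrier coder"
  shows "lift g \<in> carrier coint"
proof -
  note g = assms[unfolded coder_iff]
  have nats: "lift g \<in> nat_trans A A M (F \<odot> F)" "rlift g \<in> nat_trans A A M (F \<odot> F)"
    using g lift_nat rlift_nat by simp_all
  have "nt_map A F \<delta> \<bullet>\<^bsub>A\<^esub> lift g = lift (nt_add A (lift g) (rlift g))"
    using lift_comp[OF _ _ _ \<delta>_nat] g by simp
  also have "\<dots> = nt_add A (lift (lift g)) (rlift (lift g))"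
    using hom_mult[OF lift_hom[of "F \<odot> F"]] nats lift_rlift[OF functor_F conjunct1[OF g]] by simp
  finally show ?thesis
    using \<delta>_lift g nats unfolding coint_iff by simp
qed

lemma coint_to_coder_hom: "coint_to_coder \<in> hom (nt_group A M (F \<odot> F)) (nt_group A M F)"
  using nt_comp_left_hom[OF _ _ _ \<xi>_at_nat] by simp

lemma coint_to_coder_iso: "coint_to_coder \<in> iso coint coder"
proof -
  have "bij_betw coint_to_coder (carrier coint) (carrier coder)"
    by (rule bij_betw_byWitness[where f' = lift])
      (use lift_coint_to_coder coint_to_coder_lift coint_to_coder_mem lift_mem in
        \<open>auto simp del: Coint.simps Coder.simps simp: coder_iff\<close>)
  moreover have "coint_to_coder \<in> hom coint coder"
    using coint_to_coder_mem hom_mult[OF coint_to_coder_hom] by (intro homI) auto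
  ultimately show ?thesis by (simp add: iso_def)
qed

lemma lift_hom_coder: "lift \<in> hom coder coint"
  using lift_mem hom_mult[OF lift_hom[OF functor_F]] by (intro homI) auto

section \<open>Inner coderivations and inner cointegrations\<close>

lemma inner_coder_hom:
  "(\<lambda>\<theta>. nt_diff A (rlift \<theta>) (lift \<theta>)) \<in> hom (nt_group A M id_fun) (nt_group A M F)"
proof -
  interpret I: group "nt_group A M id_fun" by (simp add: group_nt_group)
  let ?d = "\<lambda>\<theta>. rlift \<theta> \<otimes>\<^bsub>nt_group A M F\<^esub> inv\<^bsub>nt_group A M F\<^esub> (lift \<theta>)"
  have "?d \<in> hom (nt_group A M id_fun) (nt_group A M F)"
    using hom_mult_inv_hom[OF comm_group_nt_group rlift_hom[of id_fun, simplified]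
        lift_hom[of id_fun, simplified]]
    by simp
  \<comment> \<open>Agreement on the carrier suffices: \<open>hom_restrict\<close> carries the
    homomorphism property over to the expression with \<open>nt_diff\<close>.\<close>
  moreover have "?d \<theta> = nt_diff A (rlift \<theta>) (lift \<theta>)" if "\<theta> \<in> carrier (nt_group A M id_fun)" for \<theta>
    using that lift_nat[of id_fun] rlift_nat[of id_fun]
    by (simp add: nt_diff_eq[OF functor_M functor_F])
  ultimately show ?thesis
    by (rule I.hom_restrict)
qed

text \<open>\<open>InCoder\<close> demands membership in \<open>Coder\<close>, so its carrier is the
  intersection of the coderivations with the image of the homomorphism in
  \<open>inner_coder_hom\<close>.\<close>

lemma subgroup_incoder: "subgroup (carrier incoder) coder"
proof -
  interpret N: group "nt_group A M F" by (simp add: group_nt_group)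
  interpret inn: group_hom "nt_group A M id_fun" "nt_group A M F" "\<lambda>\<theta>. nt_diff A (rlift \<theta>) (lift \<theta>)"
    using inner_coder_hom by (simp add: group_hom_def group_hom_axioms_def group_nt_group)
  have "carrier incoder = carrier coder \<inter>
      (\<lambda>\<theta>. nt_diff A (rlift \<theta>) (lift \<theta>)) ` carrier (nt_group A M id_fun)"
    by auto
  then have "subgroup (carrier incoder) (nt_group A M F)"
    using N.subgroups_Inter_pair[OF subgroup_coder inn.img_is_subgroup] by simp
  from N.subgroup_incl[OF this subgroup_coder] show ?thesis
    by (auto simp flip: coder_eq)
qed

text \<open>This turns the inner coderivation formula of \<open>\<theta>\<close> into the inner
  cointegration formula of \<open>lift \<theta>\<close>: lifting is additive, commutes with
  \<open>rlift\<close>, and yields left comodule maps.\<close>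

lemma lift_nt_diff:
  assumes "\<theta> \<in> nat_trans A A M id_fun"
  shows "lift (nt_diff A (rlift \<theta>) (lift \<theta>)) = nt_diff A (rlift (lift \<theta>)) (\<delta> \<bullet>\<^bsub>A\<^esub> lift \<theta>)"
proof -
  have \<theta>: "lift \<theta> \<in> nat_trans A A M F" "rlift \<theta> \<in> nat_trans A A M F"
    using assms lift_nat[of id_fun] rlift_nat[of id_fun] by simp_all
  have "\<delta> \<bullet>\<^bsub>A\<^esub> lift \<theta> = lift (lift \<theta>)"
    using \<delta>_lift[of id_fun] assms nt_at_id_fun[OF \<delta>_nat] by simp
  moreover have "lift (nt_diff A (rlift \<theta>) (lift \<theta>)) = nt_diff A (lift (rlift \<theta>)) (lift (lift \<theta>))"
    using hom_mult_inv[OF group_nt_group group_nt_group lift_hom[OF functor_F]] \<theta>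
      lift_nat[OF functor_F]
    by (simp add: nt_diff_eq[of M F] nt_diff_eq[of M "F \<odot> F"])
  ultimately show ?thesis
    using lift_rlift[of id_fun] assms by simp
qed

text \<open>The witness for innerness of \<open>lift g\<close> is \<open>lift \<theta>\<close>, a
  left comodule map by \<open>\<delta>_lift\<close> at \<open>id_fun\<close>.\<close>

lemma lift_incoder:
  assumes "g \<in> carrier incoder"
  shows "lift g \<in> carrier incoint"
proof -
  from assms obtain \<theta> where \<theta>: "\<theta> \<in> nat_trans A A M id_fun"
    and g: "g = nt_diff A (rlift \<theta>) (lift \<theta>)" "g \<in> carrier coder"
    by auto
  have "lift \<theta> \<in> nat_trans A A M F" "\<delta> \<bullet>\<^bsub>A\<^esub> lift \<theta> = lift (lift \<theta>)"
    using lift_nat[of id_fun] \<delta>_lift[of id_fun] \<theta> nt_at_id_fun[OF \<delta>_nat] by simp_all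
  then show ?thesis
    using lift_mem[OF g(2)] lift_nt_diff[OF \<theta>] g(1) by auto
qed

lemma coint_to_coder_incoint:
  assumes "h \<in> carrier incoint"
  shows "coint_to_coder h \<in> carrier incoder"
proof -
  from assms obtain \<phi> where \<phi>: "\<phi> \<in> nat_trans A A M F" "\<delta> \<bullet>\<^bsub>A\<^esub> \<phi> = lift \<phi>"
    and h: "h = nt_diff A (rlift \<phi>) (\<delta> \<bullet>\<^bsub>A\<^esub> \<phi>)" "h \<in> carrier coint"
    by auto
  \<comment> \<open>The cofree correspondence at \<open>id_fun\<close> recovers the transformation
    into the identity of which the comodule map \<open>\<phi>\<close> is the lift.\<close>
  define \<theta> where "\<theta> = \<xi> \<bullet>\<^bsub>A\<^esub> \<phi>"
  have \<theta>: "\<theta> \<in> nat_trans A A M id_fun"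
    unfolding \<theta>_def using nt_comp_nat_trans[OF _ _ _ \<phi>(1) \<xi>_nat] by simp
  have lift_\<theta>: "lift \<theta> = \<phi>"
    using lift_\<xi>[of id_fun] \<phi> nt_at_id_fun[OF \<delta>_nat] nt_at_id_fun[OF \<xi>_nat] by (simp add: \<theta>_def)
  \<comment> \<open>Hence \<open>h\<close> is the lift of the inner formula of
    \<open>\<theta>\<close>, and \<open>coint_to_coder\<close> undoes the lift.\<close>
  have "h = lift (nt_diff A (rlift \<theta>) (lift \<theta>))"
    using lift_nt_diff[OF \<theta>] h(1) lift_\<theta> by simp
  moreover have "nt_diff A (rlift \<theta>) (lift \<theta>) \<in> nat_trans A A M F"
    using hom_in_carrier[OF inner_coder_hom] \<theta> by simp
  ultimately have "coint_to_coder h = nt_diff A (rlift \<theta>) (lift \<theta>)"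
    using coint_to_coder_lift by simp
  then show ?thesis
    using coint_to_coder_mem[OF h(2)] \<theta> by auto
qed

lemma incoint_eq_lift_incoder: "carrier incoint = lift ` carrier incoder"
proof (intro equalityI subsetI)
  fix h assume h: "h \<in> carrier incoint"
  then have "h = lift (coint_to_coder h)"
    using lift_coint_to_coder by simp
  then show "h \<in> lift ` carrier incoder"
    using coint_to_coder_incoint[OF h] by (rule image_eqI)
qed (use lift_incoder in blast)

text \<open>By \<open>incoint_eq_lift_incoder\<close> this is the image of a subgroup under the
  homomorphism \<open>lift\<close>.\<close>

lemma subgroup_incoint: "subgroup (carrier incoint) coint"
proof -
  interpret group_hom coder coint lift
    using comm_group_coder comm_group_coint lift_hom_coder
    by (simp only: group_hom_def group_hom_axioms_def comm_group_def)
  show ?thesis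
    using subgroup_img_is_subgroup[OF subgroup_incoder] by (simp only: incoint_eq_lift_incoder)
qed

lemma coint_to_coder_iso_inner: "coint_to_coder \<in> iso incoint incoder"
proof -
  have "carrier incoint \<subseteq> carrier coint" "carrier incoder \<subseteq> nat_trans A A M F"
    by auto
  then have "bij_betw coint_to_coder (carrier incoint) (carrier incoder)"
    by (intro bij_betw_byWitness[where f' = lift] ballI image_subsetI coint_to_coder_incoint
        lift_incoder lift_coint_to_coder coint_to_coder_lift) blast+
  moreover have "coint_to_coder \<in> hom incoint incoder"
    using coint_to_coder_incoint hom_mult[OF coint_to_coder_hom] by (intro homI) auto
  ultimately show ?thesis by (simp add: iso_def)
qed

section \<open>Naturality in the bicomodule\<close>

context
  fixes M' :: "('o, 'm, 'o, 'm) cfun" and m' n' f :: "'o \<Rightarrow> 'm"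
  assumes bicomodule': "bicomodule U A F \<delta> \<xi> (M', m', n')"
    and morphism: "f \<in> bicomod_morphisms A F (M', m', n') (M, m, n)"
begin

interpretation M': comonad_bicomodule A F \<delta> \<xi> U M' m' n'
  by unfold_locales (fact bicomodule')

lemma f_nat: "f \<in> nat_trans A A M' M"
  and m_f: "m \<bullet>\<^bsub>A\<^esub> f = M'.lift f"
  and n_f: "n \<bullet>\<^bsub>A\<^esub> f = M'.rlift f"
  using morphism by simp_all

text \<open>Since \<open>f\<close> intertwines the left coactions, \<open>m \<circ> f\<close>
  becomes \<open>Ff \<circ> m'\<close>, and functoriality of \<open>F\<close> merges
  \<open>Fg\<close> with \<open>Ff\<close>.\<close>

lemma lift_comp_morphism:
  assumes "is_functor A A I" "g \<in> nat_trans A A M I"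
  shows "lift g \<bullet>\<^bsub>A\<^esub> f = M'.lift (g \<bullet>\<^bsub>A\<^esub> f)"
  using nt_comp_assoc[OF f_nat m_nat map_nat[OF assms]] m_f M'.lift_comp[OF _ assms(1) f_nat assms(2)]
  by simp

lemma rlift_comp_morphism:
  assumes "is_functor A A I" "g \<in> nat_trans A A M I"
  shows "rlift g \<bullet>\<^bsub>A\<^esub> f = M'.rlift (g \<bullet>\<^bsub>A\<^esub> f)"
  using nt_comp_assoc[OF f_nat n_nat nt_at_nat_trans[OF functor_F assms(2)]] n_f
    M'.rlift_comp[OF _ assms(1) f_nat assms(2)]
  by simp

lemma comp_morphism_hom:
  "is_functor A A I \<Longrightarrow> (\<lambda>g. g \<bullet>\<^bsub>A\<^esub> f) \<in> hom (nt_group A M I) (nt_group A M' I)"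
  by (simp add: nt_comp_right_hom f_nat)

text \<open>Precomposition with \<open>f\<close> is additive and compatible with both kinds of lift,
  so the Leibniz rule passes from \<open>g\<close> to its composite with \<open>f\<close>.\<close>

lemma coder_comp_morphism: "(\<lambda>g. g \<bullet>\<^bsub>A\<^esub> f) \<in> hom coder M'.coder"
proof (rule homI)
  fix g assume "g \<in> carrier coder"
  then have g: "g \<in> nat_trans A A M F" "\<delta> \<bullet>\<^bsub>A\<^esub> g = nt_add A (lift g) (rlift g)"
    by simp_all
  have nats: "lift g \<in> nat_trans A A M (F \<odot> F)" "rlift g \<in> nat_trans A A M (F \<odot> F)"
    using g(1) lift_nat rlift_nat by simp_all
  have "\<delta> \<bullet>\<^bsub>A\<^esub> (g \<bullet>\<^bsub>A\<^esub> f) = nt_add A (lift g \<bullet>\<^bsub>A\<^esub> f) (rlift g \<bullet>\<^bsub>A\<^esub> f)"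
    using nt_comp_assoc[OF f_nat g(1) \<delta>_nat] g(2) hom_mult[OF comp_morphism_hom[of "F \<odot> F"]] nats
    by simp
  then show "g \<bullet>\<^bsub>A\<^esub> f \<in> carrier M'.coder"
    using hom_in_carrier[OF comp_morphism_hom[OF functor_F]] g(1)
      lift_comp_morphism[OF functor_F g(1)] rlift_comp_morphism[OF functor_F g(1)]
    by simp
next
  fix g g' assume "g \<in> carrier coder" "g' \<in> carrier coder"
  then show "(g \<otimes>\<^bsub>coder\<^esub> g') \<bullet>\<^bsub>A\<^esub> f = (g \<bullet>\<^bsub>A\<^esub> f) \<otimes>\<^bsub>M'.coder\<^esub> (g' \<bullet>\<^bsub>A\<^esub> f)"
    using hom_mult[OF comp_morphism_hom[OF functor_F]] by simp
qed

lemma coint_comp_morphism: "(\<lambda>h. h \<bullet>\<^bsub>A\<^esub> f) \<in> hom coint M'.coint"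
proof (rule homI)
  fix h assume "h \<in> carrier coint"
  then have h: "h \<in> nat_trans A A M (F \<odot> F)" "nt_at A \<delta> F \<bullet>\<^bsub>A\<^esub> h = lift h"
    "nt_map A F \<delta> \<bullet>\<^bsub>A\<^esub> h = nt_add A (nt_at A \<delta> F \<bullet>\<^bsub>A\<^esub> h) (rlift h)"
    by simp_all
  have FF: "is_functor A A (F \<odot> F)" by simp
  have nats: "lift h \<in> nat_trans A A M (F \<odot> (F \<odot> F))" "rlift h \<in> nat_trans A A M (F \<odot> (F \<odot> F))"
    using lift_nat[OF FF h(1)] rlift_nat[OF FF h(1)] by (simp_all add: comp_fun_assoc)
  have \<delta>F: "nt_at A \<delta> F \<bullet>\<^bsub>A\<^esub> (h \<bullet>\<^bsub>A\<^esub> f) = M'.lift (h \<bullet>\<^bsub>A\<^esub> f)"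
    using nt_comp_assoc[OF f_nat h(1) \<delta>_at_nat[OF functor_F]] h(2) lift_comp_morphism[OF FF h(1)] by simp
  \<comment> \<open>The first equation rewrites the summand
    \<open>\<delta>\<^sub>F \<circ> h\<close> as \<open>lift h\<close>, so that both summands are
    lifts and \<open>f\<close> can be moved inside.\<close>
  have "nt_map A F \<delta> \<bullet>\<^bsub>A\<^esub> (h \<bullet>\<^bsub>A\<^esub> f) = nt_add A (lift h \<bullet>\<^bsub>A\<^esub> f) (rlift h \<bullet>\<^bsub>A\<^esub> f)"
    using nt_comp_assoc[OF f_nat h(1) F\<delta>_nat] h(2,3)
      hom_mult[OF comp_morphism_hom[of "F \<odot> (F \<odot> F)"]] nats
    by simp
  then show "h \<bullet>\<^bsub>A\<^esub> f \<in> carrier M'.coint"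
    using hom_in_carrier[OF comp_morphism_hom[OF FF]] h(1) \<delta>F
      lift_comp_morphism[OF FF h(1)] rlift_comp_morphism[OF FF h(1)]
    by simp
next
  fix h h' assume "h \<in> carrier coint" "h' \<in> carrier coint"
  then show "(h \<otimes>\<^bsub>coint\<^esub> h') \<bullet>\<^bsub>A\<^esub> f = (h \<bullet>\<^bsub>A\<^esub> f) \<otimes>\<^bsub>M'.coint\<^esub> (h' \<bullet>\<^bsub>A\<^esub> f)"
    using hom_mult[OF comp_morphism_hom[of "F \<odot> F"]] by simp
qed

text \<open>The naturality square commutes by associativity of composition.\<close>

lemma coint_to_coder_comp_morphism:
  assumes "h \<in> carrier coint"
  shows "coint_to_coder (h \<bullet>\<^bsub>A\<^esub> f) = coint_to_coder h \<bullet>\<^bsub>A\<^esub> f"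
  using nt_comp_assoc[OF f_nat _ \<xi>_at_nat[OF functor_F]] assms by simp

end

end

theorem proposition2p1:
  fixes A :: "('o, 'm) acat"
    and F M :: "('o, 'm, 'o, 'm) cfun"
    and \<delta> \<xi> m n :: "'o \<Rightarrow> 'm"
  assumes "grothendieck_category TYPE('u) A"
    and "comonad A F \<delta> \<xi>"
    and "preserves_cokernels A F"
    and "commutes_with_direct_sums TYPE('u) A F"
    and "bicomodule TYPE('u) A F \<delta> \<xi> (M, m, n)"
  shows "comm_group (Coint A F \<delta> (M, m, n) (F, \<delta>, \<delta>)) \<and>
    comm_group (Coder A F \<delta> (M, m, n)) \<and>
    (\<lambda>h. nt_at A \<xi> F \<bullet>\<^bsub>A\<^esub> h)
           \<in> iso (Coint A F \<delta> (M, m, n) (F, \<delta>, \<delta>)) (Coder A F \<delta> (M, m, n)) \<and>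
    (\<forall>g \<in> carrier (Coder A F \<delta> (M, m, n)).
           nt_map A F g \<bullet>\<^bsub>A\<^esub> m \<in> carrier (Coint A F \<delta> (M, m, n) (F, \<delta>, \<delta>)) \<and>
           nt_at A \<xi> F \<bullet>\<^bsub>A\<^esub> (nt_map A F g \<bullet>\<^bsub>A\<^esub> m) = g) \<and>
    (\<forall>h \<in> carrier (Coint A F \<delta> (M, m, n) (F, \<delta>, \<delta>)).
           nt_map A F (nt_at A \<xi> F \<bullet>\<^bsub>A\<^esub> h) \<bullet>\<^bsub>A\<^esub> m = h) \<and>
    (\<forall>M' m' n'. bicomodule TYPE('u) A F \<delta> \<xi> (M', m', n') \<longrightarrow>
           (\<forall>f \<in> bicomod_morphisms A F (M', m', n') (M, m, n).
              (\<lambda>h. h \<bullet>\<^bsub>A\<^esub> f) \<in> hom (Coint A F \<delta> (M, m, n) (F, \<delta>, \<delta>))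
                                  (Coint A F \<delta> (M', m', n') (F, \<delta>, \<delta>)) \<and>
              (\<lambda>g. g \<bullet>\<^bsub>A\<^esub> f) \<in> hom (Coder A F \<delta> (M, m, n)) (Coder A F \<delta> (M', m', n')) \<and>
              (\<forall>h \<in> carrier (Coint A F \<delta> (M, m, n) (F, \<delta>, \<delta>)).
                 nt_at A \<xi> F \<bullet>\<^bsub>A\<^esub> (h \<bullet>\<^bsub>A\<^esub> f) = (nt_at A \<xi> F \<bullet>\<^bsub>A\<^esub> h) \<bullet>\<^bsub>A\<^esub> f))) \<and>
    subgroup (carrier (InCoint A F \<delta> (M, m, n) (F, \<delta>, \<delta>)))
           (Coint A F \<delta> (M, m, n) (F, \<delta>, \<delta>)) \<and>
    subgroup (carrier (InCoder A F \<delta> (M, m, n))) (Coder A F \<delta> (M, m, n)) \<and>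
    (\<lambda>h. nt_at A \<xi> F \<bullet>\<^bsub>A\<^esub> h)
           \<in> iso (InCoint A F \<delta> (M, m, n) (F, \<delta>, \<delta>)) (InCoder A F \<delta> (M, m, n))"
proof -
  interpret additive_comonad A F \<delta> \<xi>
    using assms(1,2)
    by (simp add: additive_comonad_def additive_comonad_axioms_def grothendieck_category_def
        abelian_category_def)
  interpret comonad_bicomodule A F \<delta> \<xi> "TYPE('u)" M m n
    by unfold_locales (fact assms(5))
  show ?thesis
    using comm_group_coint comm_group_coder coint_to_coder_iso lift_mem coint_to_coder_lift
      lift_coint_to_coder coint_comp_morphism coder_comp_morphism coint_to_coder_comp_morphism
      subgroup_incoint subgroup_incoder coint_to_coder_iso_inner coder_iff
    by (intro conjI ballI allI impI) blast+
qed

end
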